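(* Consider the Lévy-driven polling system with $N\ge1$ queues, input subordinator $\boldsymbol W$ with Laplace exponent $\phi$, switch-over times $S_1,\dots,S_N$, and service disciplines satisfying the branching property with Laplace exponents $\eta_1,\dots,\eta_N$, in steady state, as described in the context. Let $\boldsymbol B_i$ and $\boldsymbol E_i$ denote random vectors having the steady-state distribution of the joint amount of fluid in the queues at the beginning of a visit to $Q_i$ and at the end of a visit to $Q_i$, respectively (with $\boldsymbol B_{N+1}:=\boldsymbol B_1$). Then, for $i=1,\dots,N$ and $\boldsymbol u\ge\boldsymbol 0$, $$\tilde{\boldsymbol B}_{i+1}(\boldsymbol u)=\tilde{\boldsymbol E}_i(\boldsymbol u)\,\tilde S_i(\phi(\boldsymbol u)),$$ $$\tilde{\boldsymbol E}_i(\boldsymbol u)=\tilde{\boldsymbol B}_i\big(u_1,\ldots,u_{i-1},\eta_i(\boldsymbol u),u_{i+1},\ldots,u_N\big),$$ where $$\tilde{\boldsymbol B}_1(\boldsymbol u)=\prod_{k=0}^\infty\tilde{\boldsymbol G}\big(\boldsymbol\kappa^{(k)}(\boldsymbol u)\big),$$ with $\boldsymbol\kappa=(\kappa_1,\dots,\kappa_N)$ given recursively by $\kappa_i(\boldsymbol u)=\eta_i(u_1,\ldots,u_i,\kappa_{i+1}(\boldsymbol u),\ldots,\kappa_N(\boldsymbol u))$, $i=1,\dots,N$ (so $\kappa_N=\eta_N$), and $$\tilde{\boldsymbol G}(\boldsymbol u)=\prod_{i=1}^N \tilde S_i\big(\phi(u_1,\ldots,u_i,\kappa_{i+1}(\boldsymbol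 u),\ldots,\kappa_N(\boldsymbol u))\big)$$ (the argument of $\tilde S_N$ being $\phi(\boldsymbol u)$).
   Context: Notation. An $N$-dimensional Lévy subordinator is an $\mathbb R^N$-valued Lévy process started at $\boldsymbol 0$ with paths non-decreasing in each coordinate (coordinates may be dependent). The Laplace exponent of a (multidimensional) spectrally positive Lévy process $\boldsymbol L$ is the function $\phi$ with $\mathbb E e^{-\boldsymbol u\cdot\boldsymbol L(t)}=e^{-t\phi(\boldsymbol u)}$, $\boldsymbol u\ge\boldsymbol 0$. For a random variable or vector $X$, $\tilde X(u)=\mathbb E e^{-u\cdot X}$. $\boldsymbol e_i$ is the $i$th unit vector. Iterates: $\boldsymbol\kappa^{(0)}(\boldsymbol u)=\boldsymbol u$, $\boldsymbol\kappa^{(k)}(\boldsymbol u)=\boldsymbol\kappa^{(k-1)}(\boldsymbol\kappa(\boldsymbol u))$. Polling system. There are $N$ infinite-buffer fluid queues $Q_1,\dots,Q_N$ and one server visiting them cyclically ($Q_{N+1}:=Q_1$). After leaving $Q_j$ and before reaching $Q_{j+1}$ the server incurs a switch-over period whose duration is a positive random variable $S_j$, independent of anything else. The queues are fed by an $N$-dimensional Lévy subordinator $\boldsymbol W$ with Laplace exponent $\phi$; during a switch-over period the workload vector increases by the increment of $\boldsymbol W$ over that period. While the server is at $Q_i$ the workload vector evolves according to a Lévy process $\boldsymbol A_i(t)=(W_1(t),\dots,W_{i-1}(t),A_i(t),W_{i+1}(t),\dots,W_N(t))$, where $A_i$ is a spectrally positive Lévy process with $\mathbb E A_i(1)<0$.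 Branching property of the discipline at $Q_i$, with Laplace exponent $\eta_i$: if the workload vector on the server's arrival at $Q_i$ is $\boldsymbol x$, then the workload vector at the end of the visit is $\boldsymbol x-x_i\boldsymbol e_i+\boldsymbol H_i(x_i)$, where $\{\boldsymbol H_i(x),x\ge0\}$ is an $N$-dimensional Lévy subordinator with Laplace exponent $\eta_i$. Independent copies of the replacement processes, switch-over durations and input increments are used in different visits and switch-over periods, independently of the past. Steady state. Let $M=(m_{i,j})$ with $m_{i,j}=\frac{\partial\kappa_i}{\partial u_j}(\boldsymbol 0)$ (finite). It is assumed that the spectral radius of $M$ is $<1$ and that a non-negative random vector $\boldsymbol G$ with transform $\tilde{\boldsymbol G}$ has integrable norm, so that the workload vector at successive epochs at which the server reaches $Q_1$ converges in distribution. $\boldsymbol B_1$ has this limiting distribution, and $\boldsymbol B_i,\boldsymbol E_i$ are distributed as the workload vectors at the beginning, respectively end, of the visit to $Q_i$ in a cycle started with workload vector distributed as $\boldsymbol B_1$ when the server reaches $Q_1$. *)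

theory Defs
  imports "HOL-Probability.Probability" "Jordan_Normal_Form.Spectral_Radius"
begin

no_notation Matrix.vec_index (infixl \<open>$\<close> 100)
no_notation Matrix.scalar_prod (infix \<open>\<bullet>\<close> 70)

text \<open>\<open>'n rvec\<close> is \<open>real ^ 'n\<close>, and \<open>'n rmat\<close> is \<open>real ^ 'n ^ 'n\<close>; unlike the \<open>^\<close> syntax, the
  synonyms do not constrain the sort of \<open>'n\<close> at every occurrence.\<close>

type_synonym 'n rvec = "(real, 'n) Finite_Cartesian_Product.vec"
type_synonym 'n rmat = "('n rvec, 'n) Finite_Cartesian_Product.vec"

section \<open>Laplace transforms, weak convergence\<close>

definition laplace :: "'a measure \<Rightarrow> ('a \<Rightarrow> 'b::real_inner) \<Rightarrow> 'b \<Rightarrow> real" where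
  "laplace M X u = (\<integral>\<omega>. exp (- (u \<bullet> X \<omega>)) \<partial>M)"

text \<open>Vectors in \<open>real ^ 'n\<close> are ordered componentwise. The values of an exponent outside the
  non-negative orthant are irrelevant and left unconstrained.\<close>

definition laplace_exponent ::
  "'a measure \<Rightarrow> (real \<Rightarrow> 'a \<Rightarrow> 'b::{real_inner, ord}) \<Rightarrow> ('b \<Rightarrow> real) \<Rightarrow> bool" where
  "laplace_exponent M X \<phi> \<longleftrightarrow> (\<forall>t\<ge>0. \<forall>u\<ge>0. laplace M (X t) u = exp (- t * \<phi> u))"

definition converges_weakly ::
  "(nat \<Rightarrow> 'b::topological_space measure) \<Rightarrow> 'b measure \<Rightarrow> bool" where
  "converges_weakly \<mu> \<nu> \<longleftrightarrow>
     (\<forall>f :: 'b \<Rightarrow> real. continuous_on UNIV f \<longrightarrow> bounded (range f) \<longrightarrow>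
        (\<lambda>n. \<integral>x. f x \<partial>\<mu> n) \<longlonglongrightarrow> (\<integral>x. f x \<partial>\<nu>))"

section \<open>Levy processes\<close>

text \<open>Time is \<open>{0..}\<close>; the values at negative times are irrelevant. Path properties hold for
  every outcome (the usual cadlag version), so that evaluation at a random time is measurable.\<close>

locale levy_process = prob_space M for M :: "'a measure" +
  fixes X :: "real \<Rightarrow> 'a \<Rightarrow> 'b::euclidean_space"
  assumes measurable: "\<And>t. 0 \<le> t \<Longrightarrow> X t \<in> borel_measurable M"
    and start: "\<And>\<omega>. \<omega> \<in> space M \<Longrightarrow> X 0 \<omega> = 0"
    and indep_increments: "\<And>(t :: nat \<Rightarrow> real) n. 0 \<le> t 0 \<Longrightarrow> incseq t \<Longrightarrow>
      indep_vars (\<lambda>_. borel) (\<lambda>k \<omega>. X (t (Suc k)) \<omega> - X (t k) \<omega>) {..<n}"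
    and stationary_increments: "\<And>s h. 0 \<le> s \<Longrightarrow> 0 \<le> h \<Longrightarrow>
      distr M borel (\<lambda>\<omega>. X (s + h) \<omega> - X s \<omega>) = distr M borel (X h)"
    and right_continuous: "\<And>t \<omega>. 0 \<le> t \<Longrightarrow> \<omega> \<in> space M \<Longrightarrow>
      ((\<lambda>s. X s \<omega>) \<longlongrightarrow> X t \<omega>) (at_right t)"
    and left_limits: "\<And>t \<omega>. 0 < t \<Longrightarrow> \<omega> \<in> space M \<Longrightarrow>
      \<exists>l. ((\<lambda>s. X s \<omega>) \<longlongrightarrow> l) (at_left t)"

locale levy_subordinator = levy_process M X
  for M :: "'a measure" and X :: "real \<Rightarrow> 'a \<Rightarrow> real ^ 'n" +
  assumes nondecreasing: "\<And>s t \<omega>. 0 \<le> s \<Longrightarrow> s \<le> t \<Longrightarrow> \<omega> \<in> space M \<Longrightarrow> X s \<omega> \<le> X t \<omega>"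

locale spectrally_positive_levy = levy_process M X
  for M :: "'a measure" and X :: "real \<Rightarrow> 'a \<Rightarrow> real" +
  assumes no_negative_jumps: "\<And>t l \<omega>. 0 < t \<Longrightarrow> \<omega> \<in> space M \<Longrightarrow>
      ((\<lambda>s. X s \<omega>) \<longlongrightarrow> l) (at_left t) \<Longrightarrow> l \<le> X t \<omega>"

section \<open>The polling system\<close>

text \<open>The queues \<open>Q\<^sub>1, \<dots>, Q\<^sub>N\<close> are the elements of a finite linearly ordered type \<open>'n\<close>,
  in increasing order, \<open>N = CARD('n)\<close>.\<close>

abbreviation first_queue :: "'n::{finite, linorder}" where
  "first_queue \<equiv> Min UNIV"

abbreviation last_queue :: "'n::{finite, linorder}" where
  "last_queue \<equiv> Max UNIV"

definition next_queue :: "'n::{finite, linorder} \<Rightarrow> 'n" where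
  "next_queue i = (if i = last_queue then first_queue else Min {j. i < j})"

text \<open>Sources of randomness: the initial workload, and what happens during the visit to a queue
  and during the subsequent switch-over period (input process and duration) in a given cycle.\<close>

datatype 'n source = Initial | Visit nat 'n | Input nat 'n | Switch nat 'n

definition generated :: "'a measure \<Rightarrow> ('a \<Rightarrow> 'b::topological_space) set \<Rightarrow> 'a set set" where
  "generated M F = sigma_sets (space M) {f -` A \<inter> space M | f A. f \<in> F \<and> A \<in> sets borel}"

text \<open>In cycle \<open>n\<close>, \<open>X n i\<close> and \<open>Y n i\<close> are the workload vectors at the beginning and at the end of
  the visit to queue \<open>i\<close>; this visit has duration \<open>D n i\<close>, the workload moves according to \<open>A n i\<close>
  during it, \<open>V n i\<close> is the copy of the input process that feeds the queues other than \<open>i\<close>,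
  and \<open>H n i\<close> is the copy of the replacement process. The switch-over period that
  follows has duration \<open>S n i\<close> and input \<open>W n i\<close>. The law of the input is given by its
  exponent \<open>\<phi>\<close>, that of the replacement process by \<open>\<eta> i\<close>, that of the process \<open>A n i\<close>
  by \<open>\<psi> i\<close>; the law of the switch-over duration is \<open>\<sigma> i\<close>.

  The processes \<open>A n i\<close> and \<open>H n i\<close> belong to the same visit and may be dependent.\<close>

locale polling_system = prob_space M
  for M :: "'a measure" +
  fixes \<phi> :: "'n::{finite, linorder} rvec \<Rightarrow> real"
    and \<psi> \<eta> :: "'n \<Rightarrow> 'n rvec \<Rightarrow> real"
    and \<sigma> :: "'n \<Rightarrow> real measure"
    and X Y :: "nat \<Rightarrow> 'n \<Rightarrow> 'a \<Rightarrow> 'n rvec"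
    and A V H W :: "nat \<Rightarrow> 'n \<Rightarrow> real \<Rightarrow> 'a \<Rightarrow> 'n rvec"
    and D S :: "nat \<Rightarrow> 'n \<Rightarrow> 'a \<Rightarrow> real"
  assumes
    initial_measurable: "X 0 first_queue \<in> borel_measurable M"
    and initial_nonneg: "\<And>\<omega>. \<omega> \<in> space M \<Longrightarrow> 0 \<le> X 0 first_queue \<omega>"
    and switch_measurable: "\<And>n i. S n i \<in> borel_measurable M"
    and switch_pos: "\<And>n i \<omega>. \<omega> \<in> space M \<Longrightarrow> 0 < S n i \<omega>"
    and switch_law: "\<And>n i. distr M borel (S n i) = \<sigma> i"
    and input: "\<And>n i. levy_subordinator M (W n i)" "\<And>n i. laplace_exponent M (W n i) \<phi>"
    and replacement: "\<And>n i. levy_subordinator M (H n i)"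
      "\<And>n i. laplace_exponent M (H n i) (\<eta> i)"
    and visit_input: "\<And>n i. levy_subordinator M (V n i)"
      "\<And>n i. laplace_exponent M (V n i) \<phi>"
    and visit_process: "\<And>n i. levy_process M (A n i)"
      "\<And>n i. laplace_exponent M (A n i) (\<psi> i)"
    and visit_process_others: "\<And>n i j t \<omega>. j \<noteq> i \<Longrightarrow> 0 \<le> t \<Longrightarrow> \<omega> \<in> space M \<Longrightarrow>
      A n i t \<omega> $ j = V n i t \<omega> $ j"
    and visit_process_own: "\<And>n i. spectrally_positive_levy M (\<lambda>t \<omega>. A n i t \<omega> $ i)"
      "\<And>n i. integrable M (\<lambda>\<omega>. A n i 1 \<omega> $ i)"
      "\<And>n i. expectation (\<lambda>\<omega>. A n i 1 \<omega> $ i) < 0"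
    and duration: "\<And>n i. D n i \<in> borel_measurable M"
      "\<And>n i \<omega>. \<omega> \<in> space M \<Longrightarrow> 0 \<le> D n i \<omega>"
    and independence: "indep_sets (\<lambda>s. case s of
        Initial \<Rightarrow> generated M {X 0 first_queue}
      | Visit n i \<Rightarrow> generated M (A n i ` {0..} \<union> H n i ` {0..})
      | Input n i \<Rightarrow> generated M (W n i ` {0..})
      | Switch n i \<Rightarrow> generated M {S n i}) UNIV"
    and visit_evolution: "\<And>n i. AE \<omega> in M. Y n i \<omega> = X n i \<omega> + A n i (D n i \<omega>) \<omega>"
    and branching: "\<And>n i \<omega>. \<omega> \<in> space M \<Longrightarrow>
      Y n i \<omega> = X n i \<omega> - (X n i \<omega> $ i) *\<^sub>R axis i 1 + H n i (X n i \<omega> $ i) \<omega>"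
    and switch_over: "\<And>n i \<omega>. \<omega> \<in> space M \<Longrightarrow>
      X (if i = last_queue then Suc n else n) (next_queue i) \<omega> = Y n i \<omega> + W n i (S n i \<omega>) \<omega>"

definition polling_workload ::
  "'a measure \<Rightarrow> ('n::{finite, linorder} rvec \<Rightarrow> real) \<Rightarrow> ('n \<Rightarrow> 'n rvec \<Rightarrow> real) \<Rightarrow>
   ('n \<Rightarrow> 'n rvec \<Rightarrow> real) \<Rightarrow> ('n \<Rightarrow> real measure) \<Rightarrow>
   (nat \<Rightarrow> 'n \<Rightarrow> 'a \<Rightarrow> 'n rvec) \<Rightarrow> (nat \<Rightarrow> 'n \<Rightarrow> 'a \<Rightarrow> 'n rvec) \<Rightarrow> bool" where
  "polling_workload M \<phi> \<psi> \<eta> \<sigma> X Y \<longleftrightarrow>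
     (\<exists>A V H W D S. polling_system M \<phi> \<psi> \<eta> \<sigma> X Y A V H W D S)"

section \<open>The branching mechanism over one cycle\<close>

function kappa_comp ::
  "('n::{finite, linorder} \<Rightarrow> 'n rvec \<Rightarrow> real) \<Rightarrow> 'n rvec \<Rightarrow> 'n \<Rightarrow> real" where
  "kappa_comp \<eta> u i = \<eta> i (\<chi> j. if j \<le> i then u $ j else kappa_comp \<eta> u j)"
  by pat_completeness auto
termination
proof (relation "Wellfounded.measure (\<lambda>(\<eta>, u, i). card {j. i < j})", goal_cases)
  case 1
  show ?case by (rule wf_measure)
next
  case (2 \<eta> u i j)
  then have "{k. j < k} \<subset> {k. i < k}"
    by (simp add: psubset_eq subset_eq set_eq_iff not_le) (meson less_trans less_irrefl)
  then have "card {k. j < k} < card {k. i < k}"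
    by (rule psubset_card_mono[OF finite])
  then show ?case by (simp only: in_measure split)
qed

declare kappa_comp.simps [simp del]

definition kappa :: "('n::{finite, linorder} \<Rightarrow> 'n rvec \<Rightarrow> real) \<Rightarrow> 'n rvec \<Rightarrow> 'n rvec" where
  "kappa \<eta> u = (\<chi> i. kappa_comp \<eta> u i)"

definition G_transform ::
  "('n::{finite, linorder} rvec \<Rightarrow> real) \<Rightarrow> ('n \<Rightarrow> 'n rvec \<Rightarrow> real) \<Rightarrow>
   ('n \<Rightarrow> real measure) \<Rightarrow> 'n rvec \<Rightarrow> real" where
  "G_transform \<phi> \<eta> \<sigma> u =
     (\<Prod>i\<in>UNIV. laplace (\<sigma> i) (\<lambda>s. s) (\<phi> (\<chi> j. if j \<le> i then u $ j else kappa \<eta> u $ j)))"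

text \<open>The square matrix as a complex matrix in the sense of \<open>Jordan_Normal_Form\<close>, rows and columns
  listed in increasing order of the indices.\<close>

definition complex_mat :: "'n::{finite, linorder} rmat \<Rightarrow> complex mat" where
  "complex_mat m = Matrix.mat CARD('n) CARD('n)
     (\<lambda>(k, l). complex_of_real
        (m $ (sorted_list_of_set UNIV ! k) $ (sorted_list_of_set UNIV ! l)))"

end

theory Submission
  imports Defs
begin

text \<open>Conditioning on the workload \<open>x\<close> met by the server and on the switch-over duration gives the
  transforms of \<open>E\<^sub>i\<close> and \<open>B\<^sub>i\<^sub>+\<^sub>1\<close> from that of \<open>B\<^sub>i\<close>; the random times at which the subordinators
  are evaluated are approximated from the right by independent times with finitely many values.
  Over a full cycle the transform at the first queue is thus multiplied by
  \<open>G(u)\<close> and its argument replaced by \<open>\<kappa>(u)\<close>. Passing to the limit law,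
  \<open>B\<^sub>1(u) = G(u) B\<^sub>1(\<kappa>(u))\<close>, which also shows that the limit law is stationary, so
  that the relations hold across the end of the cycle, and which iterates to
  \<open>B\<^sub>1(u) = (\<Prod>k<n. G(\<kappa>\<^sup>k(u))) B\<^sub>1(\<kappa>\<^sup>n(u))\<close>. It remains to see that \<open>\<kappa>\<^sup>n(u)\<close> tends to \<open>0\<close>:
  Laplace exponents of subordinators are monotone, subadditive and satisfy \<open>c f(u) \<le> f(c u)\<close> for
  \<open>0 \<le> c \<le> 1\<close>, all of which is inherited by \<open>\<kappa>\<close>, hence \<open>\<kappa>(u) \<le> M u\<close> and \<open>\<kappa>\<^sup>n(u) \<le> M\<^sup>n u\<close>.\<close>

section \<open>Laplace exponents of subordinators and the branching mechanism\<close>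

text \<open>Concavity would not do instead of subadditivity: the minimum of two coordinates is concave and
  monotone with vanishing partial derivatives at the origin, but not bounded by its derivative.\<close>

definition subadditive_exponent :: "('n::finite rvec \<Rightarrow> real) \<Rightarrow> bool" where
  "subadditive_exponent f \<longleftrightarrow> f 0 = 0 \<and>
     (\<forall>u v. 0 \<le> u \<longrightarrow> u \<le> v \<longrightarrow> f u \<le> f v) \<and>
     (\<forall>u v. 0 \<le> u \<longrightarrow> 0 \<le> v \<longrightarrow> f (u + v) \<le> f u + f v) \<and>
     (\<forall>c u. 0 \<le> c \<longrightarrow> c \<le> 1 \<longrightarrow> 0 \<le> u \<longrightarrow> c * f u \<le> f (c *\<^sub>R u))"

lemma
  assumes "subadditive_exponent f"
  shows subadditive_exponent_zero: "f 0 = 0"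
    and subadditive_exponent_mono: "0 \<le> u \<Longrightarrow> u \<le> v \<Longrightarrow> f u \<le> f v"
    and subadditive_exponent_add: "0 \<le> u \<Longrightarrow> 0 \<le> v \<Longrightarrow> f (u + v) \<le> f u + f v"
    and subadditive_exponent_scale: "0 \<le> c \<Longrightarrow> c \<le> 1 \<Longrightarrow> 0 \<le> u \<Longrightarrow> c * f u \<le> f (c *\<^sub>R u)"
    and subadditive_exponent_nonneg: "0 \<le> u \<Longrightarrow> 0 \<le> f u"
  using assms unfolding subadditive_exponent_def by (blast, blast, blast, blast, metis order_refl)

lemma inner_vec_nonneg:
  fixes u v :: "real ^ 'n"
  assumes "0 \<le> u" "0 \<le> v"
  shows "0 \<le> u \<bullet> v"
  using assms by (auto simp: inner_vec_def Finite_Cartesian_Product.less_eq_vec_def intro!: sum_nonneg mult_nonneg_nonneg)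

lemma inner_vec_mono:
  fixes u v x :: "real ^ 'n"
  assumes "u \<le> v" "0 \<le> x"
  shows "u \<bullet> x \<le> v \<bullet> x"
  using inner_vec_nonneg[of "v - u" x] assms by (simp add: inner_diff_left)

text \<open>When the fluid \<open>x $ i\<close> is replaced by a subordinator run for that time, the
  transform acquires a term \<open>a * x $ i\<close> with \<open>a\<close> a value of the exponent.
  Absorbing it into the \<open>i\<close>-th coordinate makes the result again a transform of
  \<open>x\<close>.\<close>

lemma inner_expansion_coordinate:
  fixes u x :: "real ^ 'n"
  shows "u \<bullet> (x - (x $ i) *\<^sub>R axis i 1) + a * x $ i = (\<chi> j. if j = i then a else u $ j) \<bullet> x"
proof -
  have "(\<chi> j. if j = i then a else u $ j) = u - (u $ i) *\<^sub>R axis i 1 + a *\<^sub>R axis i 1"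
    by (auto simp: Finite_Cartesian_Product.vec_eq_iff axis_def)
  then show ?thesis
    by (simp only:) (simp add: inner_diff_right inner_diff_left inner_add_left inner_axis inner_axis' algebra_simps)
qed

text \<open>Since \<open>1 - exp (- t a)\<close> is \<open>t a\<close> to first order in \<open>t\<close>, inequalities between expectations of
  \<open>1 - exp (- (u \<bullet> X t))\<close> pass to Laplace exponents.\<close>

lemma one_minus_exp_comparison:
  fixes a b c p q :: real
  assumes "\<And>t. 0 < t \<Longrightarrow> p * (1 - exp (- t * a)) \<le> q * (1 - exp (- t * b)) + (1 - exp (- t * c))"
  shows "p * a \<le> q * b + c"
proof -
  have lim: "((\<lambda>t. (1 - exp (- t * x)) / t) \<longlongrightarrow> x) (at_right 0)" for x :: real
  proof -
    have "((\<lambda>t. 1 - exp (- t * x)) has_real_derivative x) (at 0 within {0<..})"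
      by (auto intro!: derivative_eq_intros)
    then show ?thesis by (simp add: has_field_derivative_iff)
  qed
  show ?thesis
  proof (rule tendsto_le)
    show "((\<lambda>t. p * ((1 - exp (- t * a)) / t)) \<longlongrightarrow> p * a) (at_right 0)"
      by (intro tendsto_intros lim)
    show "((\<lambda>t. q * ((1 - exp (- t * b)) / t) + (1 - exp (- t * c)) / t) \<longlongrightarrow> q * b + c) (at_right 0)"
      by (intro tendsto_intros lim)
    have "p * ((1 - exp (- t * a)) / t) \<le> q * ((1 - exp (- t * b)) / t) + (1 - exp (- t * c)) / t"
      if "0 < t" for t
      using divide_right_mono[OF assms[OF that], of t] that by (simp add: add_divide_distrib)
    then show "\<forall>\<^sub>F t in at_right 0. p * ((1 - exp (- t * a)) / t)
        \<le> q * ((1 - exp (- t * b)) / t) + (1 - exp (- t * c)) / t"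
      by (auto simp: eventually_at_filter)
  qed simp
qed

text \<open>Pointwise source of subadditivity: the gap between the two sides is a product of two
  non-negative factors.\<close>

lemma one_minus_exp_add_le:
  fixes a b :: real
  assumes "0 \<le> a" "0 \<le> b"
  shows "1 - exp (- (a + b)) \<le> (1 - exp (- a)) + (1 - exp (- b))"
proof -
  have "0 \<le> (1 - exp (- a)) * (1 - exp (- b))"
    using assms by (intro mult_nonneg_nonneg) auto
  then show ?thesis by (simp add: exp_add[symmetric] algebra_simps)
qed

text \<open>Convexity of \<open>exp\<close> on the segment from \<open>0\<close> to
  \<open>- a\<close>.\<close>

lemma one_minus_exp_scale_le:
  fixes a c :: real
  assumes "0 \<le> c" "c \<le> 1"
  shows "c * (1 - exp (- a)) \<le> 1 - exp (- (c * a))"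
proof -
  have "exp ((1 - c) *\<^sub>R 0 + c *\<^sub>R (- a)) \<le> (1 - c) * exp 0 + c * exp (- a)"
    using assms exp_convex by (intro convex_onD[of UNIV exp]) auto
  then show ?thesis by (simp add: algebra_simps)
qed

context levy_subordinator
begin

lemma nonneg: "0 \<le> t \<Longrightarrow> \<omega> \<in> space M \<Longrightarrow> 0 \<le> X t \<omega>"
  using nondecreasing[of 0 t \<omega>] start by simp

lemma integrable_exp:
  assumes "0 \<le> t" "0 \<le> u"
  shows "integrable M (\<lambda>\<omega>. exp (- (u \<bullet> X t \<omega>)))"
proof (rule integrable_const_bound[where B = 1])
  show "AE \<omega> in M. norm (exp (- (u \<bullet> X t \<omega>))) \<le> 1"
    using assms by (auto intro!: inner_vec_nonneg nonneg)
  show "(\<lambda>\<omega>. exp (- (u \<bullet> X t \<omega>))) \<in> borel_measurable M"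
    using measurable[OF assms(1)] by measurable
qed

text \<open>The inequalities hold outcome by outcome for
  \<open>1 - exp (- (u \<bullet> X t))\<close>, since \<open>X t\<close> has non-negative
  coordinates. Taking expectations and letting \<open>t\<close> decrease to \<open>0\<close> passes
  them to \<open>\<phi>\<close>.\<close>

lemma subadditive_exponent_laplace_exponent:
  assumes "laplace_exponent M X \<phi>"
  shows "subadditive_exponent \<phi>"
proof -
  have E: "expectation (\<lambda>\<omega>. 1 - exp (- (u \<bullet> X t \<omega>))) = 1 - exp (- t * \<phi> u)"
    "integrable M (\<lambda>\<omega>. 1 - exp (- (u \<bullet> X t \<omega>)))" if "0 \<le> t" "0 \<le> u" for t u
    using assms that integrable_exp[OF that]
    by (auto simp: laplace_exponent_def laplace_def prob_space)
  show ?thesis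
    unfolding subadditive_exponent_def
  proof (intro conjI allI impI)
    show "\<phi> 0 = 0"
      using assms[unfolded laplace_exponent_def, rule_format, of 1 0] by (simp add: laplace_def prob_space)
  next
    fix u v :: "'n rvec" assume uv: "0 \<le> u" "u \<le> v"
    then have v: "0 \<le> v" by (rule order_trans)
    \<comment> \<open>The comparison is stated for three exponents; the factor \<open>0\<close> and
      the exponent \<open>0\<close> blank out the middle one.\<close>
    have "1 * \<phi> u \<le> 0 * 0 + \<phi> v"
    proof (rule one_minus_exp_comparison)
      fix t :: real assume t: "0 < t"
      have "expectation (\<lambda>\<omega>. 1 - exp (- (u \<bullet> X t \<omega>))) \<le> expectation (\<lambda>\<omega>. 1 - exp (- (v \<bullet> X t \<omega>)))"
        using t uv v by (intro integral_mono E) (auto intro!: inner_vec_mono nonneg)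
      then show "1 * (1 - exp (- t * \<phi> u)) \<le> 0 * (1 - exp (- t * 0)) + (1 - exp (- t * \<phi> v))"
        using t uv v by (simp add: E)
    qed
    then show "\<phi> u \<le> \<phi> v" by simp
  next
    fix u v :: "'n rvec" assume uv: "0 \<le> u" "0 \<le> v"
    then have s: "0 \<le> u + v" by (rule add_nonneg_nonneg)
    have "1 * \<phi> (u + v) \<le> 1 * \<phi> u + \<phi> v"
    proof (rule one_minus_exp_comparison)
      fix t :: real assume t: "0 < t"
      have "expectation (\<lambda>\<omega>. 1 - exp (- ((u + v) \<bullet> X t \<omega>)))
          \<le> expectation (\<lambda>\<omega>. (1 - exp (- (u \<bullet> X t \<omega>))) + (1 - exp (- (v \<bullet> X t \<omega>))))"
        unfolding inner_add_left
        using t uv s by (intro integral_mono Bochner_Integration.integrable_add E one_minus_exp_add_le)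
          (auto simp: inner_add_left[symmetric] intro!: inner_vec_nonneg nonneg E)
      also have "\<dots> = expectation (\<lambda>\<omega>. 1 - exp (- (u \<bullet> X t \<omega>))) + expectation (\<lambda>\<omega>. 1 - exp (- (v \<bullet> X t \<omega>)))"
        using t uv by (intro Bochner_Integration.integral_add E) auto
      finally show "1 * (1 - exp (- t * \<phi> (u + v))) \<le> 1 * (1 - exp (- t * \<phi> u)) + (1 - exp (- t * \<phi> v))"
        using t uv s by (simp add: E)
    qed
    then show "\<phi> (u + v) \<le> \<phi> u + \<phi> v" by simp
  next
    fix c :: real and u :: "'n rvec" assume c: "0 \<le> c" "c \<le> 1" and u: "0 \<le> u"
    then have cu: "0 \<le> c *\<^sub>R u" by (simp add: Finite_Cartesian_Product.less_eq_vec_def)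
    have "c * \<phi> u \<le> 0 * 0 + \<phi> (c *\<^sub>R u)"
    proof (rule one_minus_exp_comparison)
      fix t :: real assume t: "0 < t"
      have "expectation (\<lambda>\<omega>. c * (1 - exp (- (u \<bullet> X t \<omega>))))
          \<le> expectation (\<lambda>\<omega>. 1 - exp (- ((c *\<^sub>R u) \<bullet> X t \<omega>)))"
        using t u cu one_minus_exp_scale_le[OF c] by (intro integral_mono integrable_mult_right E) auto
      then show "c * (1 - exp (- t * \<phi> u)) \<le> 0 * (1 - exp (- t * 0)) + (1 - exp (- t * \<phi> (c *\<^sub>R u)))"
        using t u cu by (simp add: E del: inner_scaleR_left)
    qed
    then show "c * \<phi> u \<le> \<phi> (c *\<^sub>R u)" by simp
  qed
qed

end

section \<open>The branching mechanism and its domination by the mean matrix\<close>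

lemma kappa_nth: "kappa \<eta> u $ i = \<eta> i (\<chi> j. if j \<le> i then u $ j else kappa \<eta> u $ j)"
  unfolding kappa_def by (simp add: kappa_comp.simps[of \<eta> u i] cong: if_cong)

text \<open>\<open>kappa\<close> at a queue is defined through its values at later queues, so facts
  about it are proved from the last queue backwards.\<close>

lemma queue_induct_down:
  fixes i :: "'n::{finite, linorder}"
  assumes "\<And>i. (\<And>j. i < j \<Longrightarrow> Q j) \<Longrightarrow> Q i"
  shows "Q i"
proof (rule wf_induct_rule[of "{(i, j). j < (i :: 'n)}"])
  show "wf {(i, j). j < (i :: 'n)}"
  proof (rule finite_acyclic_wf)
    show "acyclic {(i, j). j < (i :: 'n)}"
    proof (rule acyclicI_order[where f = id])
      show "id b < id a" if "(a, b) \<in> {(i, j). j < (i :: 'n)}" for a b using that by simp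
    qed
  qed simp
qed (use assms in auto)

text \<open>The properties survive composition: each coordinate of the argument of
  \<open>\<eta> i\<close> is a coordinate of \<open>u\<close> or a value of \<open>kappa\<close> at
  a later queue, and monotonicity of \<open>\<eta> i\<close> absorbs the coordinatewise
  inequalities.\<close>

lemma subadditive_exponent_kappa:
  fixes \<eta> :: "'n::{finite, linorder} \<Rightarrow> 'n rvec \<Rightarrow> real"
  assumes "\<And>i. subadditive_exponent (\<eta> i)"
  shows "subadditive_exponent (\<lambda>u. kappa \<eta> u $ i)"
proof (induction i rule: queue_induct_down)
  case (1 i)
  define w where "w u = (\<chi> j. if j \<le> i then u $ j else kappa \<eta> u $ j)" for u
  have kw: "kappa \<eta> u $ i = \<eta> i (w u)" for u unfolding w_def by (rule kappa_nth)
  \<comment> \<open>The hypothesis covers \<open>i < j\<close>; written as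
    \<open>\<not> j \<le> i\<close> it matches the second branch of \<open>w\<close>.\<close>
  note IH = 1[unfolded not_le[symmetric]]
  have pos: "0 \<le> w u" if "0 \<le> u" for u
    using that subadditive_exponent_nonneg[OF IH] by (auto simp: w_def Finite_Cartesian_Product.less_eq_vec_def)
  note \<eta> = assms[of i]
  show ?case
    unfolding subadditive_exponent_def kw
  proof (intro conjI allI impI)
    have "w 0 = 0" using subadditive_exponent_zero[OF IH] by (auto simp: w_def Finite_Cartesian_Product.vec_eq_iff)
    then show "\<eta> i (w 0) = 0" using subadditive_exponent_zero[OF \<eta>] by simp
  next
    fix u v :: "'n rvec" assume uv: "0 \<le> u" "u \<le> v"
    have "w u \<le> w v"
      using uv subadditive_exponent_mono[OF IH uv] by (auto simp: w_def Finite_Cartesian_Product.less_eq_vec_def)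
    then show "\<eta> i (w u) \<le> \<eta> i (w v)"
      by (intro subadditive_exponent_mono[OF \<eta>] pos uv)
  next
    fix u v :: "'n rvec" assume uv: "0 \<le> u" "0 \<le> v"
    have "w (u + v) \<le> w u + w v"
      using subadditive_exponent_add[OF IH uv] by (auto simp: w_def Finite_Cartesian_Product.less_eq_vec_def)
    then have "\<eta> i (w (u + v)) \<le> \<eta> i (w u + w v)"
      using uv by (intro subadditive_exponent_mono[OF \<eta>] pos) (auto intro: add_nonneg_nonneg)
    also have "\<dots> \<le> \<eta> i (w u) + \<eta> i (w v)"
      by (intro subadditive_exponent_add[OF \<eta>] pos uv)
    finally show "\<eta> i (w (u + v)) \<le> \<eta> i (w u) + \<eta> i (w v)" .
  next
    fix c :: real and u :: "'n rvec" assume c: "0 \<le> c" "c \<le> 1" and u: "0 \<le> u"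
    have "c * \<eta> i (w u) \<le> \<eta> i (c *\<^sub>R w u)"
      by (intro subadditive_exponent_scale[OF \<eta>] pos c u)
    also have "\<dots> \<le> \<eta> i (w (c *\<^sub>R u))"
    proof (rule subadditive_exponent_mono[OF \<eta>])
      show "0 \<le> c *\<^sub>R w u" using c pos[OF u] by (simp add: Finite_Cartesian_Product.less_eq_vec_def)
      show "c *\<^sub>R w u \<le> w (c *\<^sub>R u)"
        using subadditive_exponent_scale[OF IH c u] by (auto simp: w_def Finite_Cartesian_Product.less_eq_vec_def)
    qed
    finally show "c * \<eta> i (w u) \<le> \<eta> i (w (c *\<^sub>R u))" .
  qed
qed

lemma subadditive_exponent_sum:
  assumes f: "subadditive_exponent f" and "finite J" "\<And>j. j \<in> J \<Longrightarrow> 0 \<le> x j"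
  shows "f (\<Sum>j\<in>J. x j) \<le> (\<Sum>j\<in>J. f (x j))"
  using assms(2,3)
proof (induction J rule: finite_induct)
  case empty
  then show ?case using subadditive_exponent_zero[OF f] by simp
next
  case (insert j J)
  have "f (x j + sum x J) \<le> f (x j) + f (sum x J)"
    using insert.prems by (intro subadditive_exponent_add[OF f] sum_nonneg) auto
  also have "f (sum x J) \<le> (\<Sum>j\<in>J. f (x j))" by (rule insert.IH) (use insert.prems in auto)
  finally show ?case using insert.hyps by simp
qed

text \<open>Along the ray through \<open>axis j 1\<close> the quotient
  \<open>f (s *\<^sub>R axis j 1) / s\<close> does not increase with \<open>s\<close>, so its value
  at \<open>h\<close> is at most its limit at \<open>0\<close>, the one-sided derivative.\<close>

lemma subadditive_exponent_axis_le_derivative: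
  assumes f: "subadditive_exponent f" and h: "0 \<le> h"
    and d: "((\<lambda>h. f (h *\<^sub>R axis j 1)) has_real_derivative d) (at 0 within {0..})"
  shows "f (h *\<^sub>R axis j 1) \<le> h * d"
proof (cases "h = 0")
  case True
  then show ?thesis using subadditive_exponent_zero[OF f] by simp
next
  case False
  with h have h: "0 < h" by simp
  have "((\<lambda>h. f (h *\<^sub>R axis j 1)) has_real_derivative d) (at 0 within {0<..})"
    using d by (rule has_field_derivative_subset) auto
  then have lim: "((\<lambda>s. f (s *\<^sub>R axis j 1) / s) \<longlongrightarrow> d) (at_right 0)"
    using subadditive_exponent_zero[OF f] by (simp add: has_field_derivative_iff)
  have "f (h *\<^sub>R axis j 1) / h \<le> d"
  proof (rule tendsto_lowerbound[OF lim])
    have "f (h *\<^sub>R axis j 1) / h \<le> f (s *\<^sub>R axis j 1) / s" if s: "0 < s" "s \<le> h" for s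
    proof -
      \<comment> \<open>The scaling property with factor \<open>s / h\<close> is the monotonicity of
        the quotient.\<close>
      have "(s / h) * f (h *\<^sub>R axis j 1) \<le> f ((s / h) *\<^sub>R h *\<^sub>R axis j 1)"
        using s h by (intro subadditive_exponent_scale[OF f]) (auto simp: Finite_Cartesian_Product.less_eq_vec_def axis_def)
      then show ?thesis using s h by (simp add: field_simps)
    qed
    then show "\<forall>\<^sub>F s in at_right 0. f (h *\<^sub>R axis j 1) / h \<le> f (s *\<^sub>R axis j 1) / s"
      using eventually_at_right_less[of 0] eventually_at_right_real[OF h]
      by (auto elim!: eventually_mono)
  qed simp
  then show ?thesis using h by (simp add: field_simps)
qed

text \<open>Subadditivity splits \<open>u\<close> into multiples of unit vectors, where the bound by
  the one-sided derivative applies.\<close>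

lemma kappa_le_mean_matrix:
  assumes "\<And>i. subadditive_exponent (\<eta> i)" and u: "0 \<le> u"
    and m: "\<And>i j. ((\<lambda>h. kappa \<eta> (h *\<^sub>R axis j 1) $ i) has_real_derivative m $ i $ j) (at 0 within {0..})"
  shows "kappa \<eta> u \<le> m *v u"
  unfolding Finite_Cartesian_Product.less_eq_vec_def
proof
  fix i
  note \<kappa> = subadditive_exponent_kappa[of \<eta> i, OF assms(1)]
  have "kappa \<eta> u $ i = kappa \<eta> (\<Sum>j\<in>UNIV. u $ j *\<^sub>R axis j 1) $ i"
    by (simp add: basis_expansion flip: scalar_mult_eq_scaleR)
  also have "\<dots> \<le> (\<Sum>j\<in>UNIV. kappa \<eta> (u $ j *\<^sub>R axis j 1) $ i)"
    using u by (intro subadditive_exponent_sum[OF \<kappa>]) (auto simp: Finite_Cartesian_Product.less_eq_vec_def axis_def)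
  also have "\<dots> \<le> (\<Sum>j\<in>UNIV. u $ j * m $ i $ j)"
    using u by (intro sum_mono subadditive_exponent_axis_le_derivative[OF \<kappa>] m) (simp add: Finite_Cartesian_Product.less_eq_vec_def)
  also have "\<dots> = (m *v u) $ i" by (simp add: matrix_vector_mult_def mult.commute)
  finally show "kappa \<eta> u $ i \<le> (m *v u) $ i" .
qed

text \<open>An entry dominates a non-negative value of \<open>kappa\<close> at a unit
  vector.\<close>

lemma mean_matrix_nonneg:
  assumes "\<And>i. subadditive_exponent (\<eta> i)"
    and m: "\<And>i j. ((\<lambda>h. kappa \<eta> (h *\<^sub>R axis j 1) $ i) has_real_derivative m $ i $ j) (at 0 within {0..})"
  shows "0 \<le> m $ i $ j"
proof -
  note \<kappa> = subadditive_exponent_kappa[of \<eta> i, OF assms(1)]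
  have e: "0 \<le> (axis j 1 :: 'a rvec)" by (simp add: Finite_Cartesian_Product.less_eq_vec_def axis_def)
  then have "0 \<le> kappa \<eta> (1 *\<^sub>R axis j 1) $ i"
    using subadditive_exponent_nonneg[OF \<kappa>] by simp
  also have "\<dots> \<le> 1 * m $ i $ j"
    by (rule subadditive_exponent_axis_le_derivative[OF \<kappa> _ m]) simp
  finally show ?thesis by simp
qed

lemma kappa_nonneg:
  assumes "\<And>i. subadditive_exponent (\<eta> i)" and "0 \<le> u"
  shows "0 \<le> kappa \<eta> u"
  using subadditive_exponent_nonneg[OF subadditive_exponent_kappa[OF assms(1)] assms(2)]
  by (simp add: Finite_Cartesian_Product.less_eq_vec_def)

section \<open>Powers of the mean matrix\<close>

lemma pow_smult_mat:
  fixes A :: "'a::comm_semiring_1 mat"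
  assumes A: "A \<in> carrier_mat n n"
  shows "(c \<cdot>\<^sub>m A) ^\<^sub>m k = c ^ k \<cdot>\<^sub>m (A ^\<^sub>m k)"
proof (induction k)
  case 0
  then show ?case using A by (intro eq_matI) auto
next
  case (Suc k)
  have "(c \<cdot>\<^sub>m A) ^\<^sub>m Suc k = (c ^ k \<cdot>\<^sub>m (A ^\<^sub>m k)) * (c \<cdot>\<^sub>m A)" using Suc by simp
  also have "\<dots> = c ^ Suc k \<cdot>\<^sub>m (A ^\<^sub>m Suc k)"
    using A pow_carrier_mat[OF A, of k]
    by (auto simp: mult_smult_distrib[of _ n n _ n] mult_smult_assoc_mat[of _ n n _ n] mult_ac intro!: eq_matI)
  finally show ?case .
qed

lemma eigenvalue_smult_mat:
  fixes A :: "'a::field mat"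
  assumes A: "A \<in> carrier_mat n n" and "c \<noteq> 0" and ev: "eigenvalue (c \<cdot>\<^sub>m A) a"
  shows "eigenvalue A (a / c)"
proof -
  obtain v where v: "v \<in> carrier_vec n" "v \<noteq> 0\<^sub>v n" "(c \<cdot>\<^sub>m A) *\<^sub>v v = a \<cdot>\<^sub>v v"
    using ev A by (auto simp: eigenvalue_def eigenvector_def)
  have "c \<cdot>\<^sub>v (A *\<^sub>v v) = a \<cdot>\<^sub>v v"
    using A v(1) by (subst v(3)[symmetric]) (auto simp: scalar_prod_def sum_distrib_left mult_ac intro!: eq_vecI)
  then have "inverse c \<cdot>\<^sub>v (c \<cdot>\<^sub>v (A *\<^sub>v v)) = inverse c \<cdot>\<^sub>v (a \<cdot>\<^sub>v v)" by simp
  then have "A *\<^sub>v v = (a / c) \<cdot>\<^sub>v v"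
    using \<open>c \<noteq> 0\<close> by (simp add: smult_smult_assoc divide_inverse mult.commute)
  then show ?thesis using A v by (auto simp: eigenvalue_def eigenvector_def)
qed

text \<open>Dividing \<open>A\<close> by some \<open>r\<close> strictly between its spectral radius
  and \<open>1\<close> keeps the spectral radius below \<open>1\<close>. The powers of the quotient
  are therefore bounded, and those of \<open>A\<close> are of order \<open>r ^ k\<close>.\<close>

lemma spectral_radius_less_1_pow_tendsto_0:
  assumes A: "A \<in> carrier_mat n n" and n: "0 < n" and sr: "spectral_radius A < 1"
    and ij: "i < n" "j < n"
  shows "(\<lambda>k. (A ^\<^sub>m k) $$ (i, j)) \<longlonglongrightarrow> 0"
proof -
  have "0 \<le> spectral_radius A" using spectral_radius_mem_max(1)[OF A n] by auto
  with sr obtain r where r: "0 < r" "spectral_radius A < r" "r < 1"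
    by (metis dense order_le_less_trans)
  define c where "c = complex_of_real (1 / r)"
  have c: "c \<noteq> 0" "norm c = 1 / r" using r by (auto simp: c_def norm_divide)
  have cA: "c \<cdot>\<^sub>m A \<in> carrier_mat n n" using A by simp
  have "spectral_radius (c \<cdot>\<^sub>m A) < 1"
  proof -
    obtain a where a: "eigenvalue (c \<cdot>\<^sub>m A) a" "spectral_radius (c \<cdot>\<^sub>m A) = norm a"
      using spectral_radius_mem_max(1)[OF cA n] by (auto simp: spectrum_def)
    have "norm (a / c) \<le> spectral_radius A"
      using spectral_radius_mem_max(2)[OF A n] eigenvalue_smult_mat[OF A c(1) a(1)]
      by (auto simp: spectrum_def)
    moreover have "norm (a / c) = norm a * r" using r c by (simp add: norm_divide)
    ultimately have "norm a * r < 1 * r" using r by linarith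
    then show ?thesis unfolding a(2) using r by simp
  qed
  from spectral_radius_jnf_norm_bound_less_1_upper_triangular[OF cA this]
  obtain b where b: "\<And>k. norm_bound ((c \<cdot>\<^sub>m A) ^\<^sub>m k) b" by blast
  have bound: "norm ((A ^\<^sub>m k) $$ (i, j)) \<le> b * r ^ k" for k
  proof -
    have "norm (((c \<cdot>\<^sub>m A) ^\<^sub>m k) $$ (i, j)) \<le> b"
      using b[of k] ij unfolding norm_bound_def carrier_matD[OF pow_carrier_mat[OF cA, of k]] by blast
    moreover have "norm (((c \<cdot>\<^sub>m A) ^\<^sub>m k) $$ (i, j)) = norm ((A ^\<^sub>m k) $$ (i, j)) / r ^ k"
    proof -
      have dims: "i < dim_row (A ^\<^sub>m k)" "j < dim_col (A ^\<^sub>m k)"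
        using ij unfolding carrier_matD[OF pow_carrier_mat[OF A, of k]] by blast+
      then show ?thesis
        unfolding pow_smult_mat[OF A] index_smult_mat(1)[OF dims]
        by (simp add: norm_mult norm_power c(2) power_one_over)
    qed
    ultimately show ?thesis using r by (simp add: pos_divide_le_eq)
  qed
  have "(\<lambda>k. b * r ^ k) \<longlonglongrightarrow> 0"
    using r by (intro tendsto_mult_right_zero LIMSEQ_realpow_zero) auto
  then show ?thesis
    by (rule Lim_null_comparison[OF always_eventually, rotated]) (use bound in blast)
qed

lemma bij_betw_sorted_list_of_UNIV:
  "bij_betw (\<lambda>k. sorted_list_of_set (UNIV :: 'n::{finite, linorder} set) ! k) {..<CARD('n)} UNIV"
  by (rule bij_betw_nth) auto

text \<open>Transfer between two representations of matrices: \<open>q\<close> lists the queues in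
  increasing order and \<open>cv\<close> turns a real vector into a complex one indexed by position,
  so that multiplication by \<open>m\<close> becomes multiplication by
  \<open>complex_mat m\<close>.\<close>

lemma iterated_mean_matrix_tendsto_0:
  fixes m :: "'n::{finite, linorder} rmat" and u :: "'n rvec"
  assumes sr: "spectral_radius (complex_mat m) < 1"
  shows "(\<lambda>k. ((\<lambda>v. m *v v) ^^ k) u) \<longlonglongrightarrow> 0"
proof -
  define q where "q k = sorted_list_of_set (UNIV :: 'n set) ! k" for k
  define cv where "cv v = Matrix.vec CARD('n) (\<lambda>k. complex_of_real (v $ q k))" for v :: "'n rvec"
  let ?A = "complex_mat m"
  have bij: "bij_betw q {..<CARD('n)} UNIV"
    unfolding q_def by (rule bij_betw_sorted_list_of_UNIV)
  have A: "?A \<in> carrier_mat CARD('n) CARD('n)" by (simp add: complex_mat_def)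
  have cv: "cv v \<in> carrier_vec CARD('n)" for v by (simp add: cv_def)
  have step: "cv (m *v v) = ?A *\<^sub>v cv v" for v
  proof (rule eq_vecI)
    fix k assume "k < dim_vec (?A *\<^sub>v cv v)"
    then have k: "k < CARD('n)" using A by simp
    have "Matrix.vec_index (?A *\<^sub>v cv v) k = (\<Sum>l<CARD('n). complex_of_real (m $ q k $ q l * v $ q l))"
      using k by (simp add: complex_mat_def cv_def scalar_prod_def q_def lessThan_atLeast0)
    also have "\<dots> = (\<Sum>j\<in>UNIV. complex_of_real (m $ q k $ j * v $ j))"
      by (rule sum.reindex_bij_betw[OF bij])
    finally show "Matrix.vec_index (cv (m *v v)) k = Matrix.vec_index (?A *\<^sub>v cv v) k"
      using k by (simp add: cv_def matrix_vector_mult_def)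
  qed (simp add: cv_def complex_mat_def)
  have iter: "cv (((\<lambda>v. m *v v) ^^ k) u) = ?A ^\<^sub>m k *\<^sub>v cv u" for k
  proof (induction k arbitrary: u)
    case 0
    then show ?case using A cv by simp
  next
    case (Suc k)
    have "cv (((\<lambda>v. m *v v) ^^ Suc k) u) = ?A ^\<^sub>m k *\<^sub>v (?A *\<^sub>v cv u)"
      by (simp only: funpow_Suc_right o_apply Suc step)
    also have "\<dots> = ?A ^\<^sub>m Suc k *\<^sub>v cv u"
      using assoc_mult_mat_vec[OF pow_carrier_mat[OF A, of k] A cv] by simp
    finally show ?case .
  qed
  show ?thesis
  proof (rule vec_tendstoI)
    fix i :: 'n
    obtain k where k: "k < CARD('n)" "q k = i"
      using bij by (metis UNIV_I bij_betw_def imageE lessThan_iff)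
    have eq: "complex_of_real (((\<lambda>v. m *v v) ^^ p) u $ i)
        = (\<Sum>l<CARD('n). (?A ^\<^sub>m p) $$ (k, l) * complex_of_real (u $ q l))" for p
    proof -
      have "complex_of_real (((\<lambda>v. m *v v) ^^ p) u $ i) = Matrix.vec_index (cv (((\<lambda>v. m *v v) ^^ p) u)) k"
        using k by (simp add: cv_def)
      also have "\<dots> = (\<Sum>l<CARD('n). (?A ^\<^sub>m p) $$ (k, l) * complex_of_real (u $ q l))"
        unfolding iter using k carrier_matD[OF pow_carrier_mat[OF A, of p]]
        by (simp add: scalar_prod_def cv_def lessThan_atLeast0)
      finally show ?thesis .
    qed
    have "(\<lambda>p. \<Sum>l<CARD('n). (?A ^\<^sub>m p) $$ (k, l) * complex_of_real (u $ q l))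
        \<longlonglongrightarrow> (\<Sum>l<CARD('n). 0 * complex_of_real (u $ q l))"
      using k by (intro tendsto_intros spectral_radius_less_1_pow_tendsto_0[OF A _ sr]) auto
    then have "(\<lambda>p. complex_of_real (((\<lambda>v. m *v v) ^^ p) u $ i)) \<longlonglongrightarrow> complex_of_real 0"
      unfolding eq by simp
    then have "(\<lambda>p. ((\<lambda>v. m *v v) ^^ p) u $ i) \<longlonglongrightarrow> 0"
      by (simp only: tendsto_of_real_iff)
    then show "(\<lambda>p. ((\<lambda>v. m *v v) ^^ p) u $ i) \<longlonglongrightarrow> 0 $ i" by simp
  qed
qed

lemma iterated_kappa_nonneg:
  assumes "\<And>i. subadditive_exponent (\<eta> i)" and "0 \<le> u"
  shows "0 \<le> (kappa \<eta> ^^ k) u"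
  using assms(2) by (induction k) (auto intro: kappa_nonneg assms(1))

text \<open>The iterates of \<open>kappa\<close> are squeezed between \<open>0\<close> and those of
  the mean matrix.\<close>

lemma iterated_kappa_tendsto_0:
  assumes \<eta>: "\<And>i. subadditive_exponent (\<eta> i)" and u: "0 \<le> u"
    and m: "\<And>i j. ((\<lambda>h. kappa \<eta> (h *\<^sub>R axis j 1) $ i) has_real_derivative m $ i $ j) (at 0 within {0..})"
    and sr: "spectral_radius (complex_mat m) < 1"
  shows "(\<lambda>k. (kappa \<eta> ^^ k) u) \<longlonglongrightarrow> 0"
proof -
  have bound: "(kappa \<eta> ^^ k) u \<le> ((\<lambda>v. m *v v) ^^ k) u" for k
  proof (induction k)
    case (Suc k)
    have "kappa \<eta> ((kappa \<eta> ^^ k) u) \<le> m *v ((kappa \<eta> ^^ k) u)"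
      by (intro kappa_le_mean_matrix \<eta> m iterated_kappa_nonneg u)
    \<comment> \<open>Multiplication by \<open>m\<close> preserves the order because its entries are
      non-negative.\<close>
    also have "\<dots> \<le> m *v (((\<lambda>v. m *v v) ^^ k) u)"
      using Suc mean_matrix_nonneg[OF \<eta> m]
      by (auto simp: Finite_Cartesian_Product.less_eq_vec_def matrix_vector_mult_def
          intro!: sum_mono mult_left_mono)
    finally show ?case by simp
  qed simp
  show ?thesis
  proof (rule vec_tendstoI)
    fix i
    show "(\<lambda>k. (kappa \<eta> ^^ k) u $ i) \<longlonglongrightarrow> 0 $ i"
    proof (rule tendsto_sandwich)
      show "\<forall>\<^sub>F k in sequentially. 0 \<le> (kappa \<eta> ^^ k) u $ i"
        using iterated_kappa_nonneg[OF \<eta> u] by (simp add: Finite_Cartesian_Product.less_eq_vec_def)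
      show "\<forall>\<^sub>F k in sequentially. (kappa \<eta> ^^ k) u $ i \<le> ((\<lambda>v. m *v v) ^^ k) u $ i"
        using bound by (simp add: Finite_Cartesian_Product.less_eq_vec_def)
      show "(\<lambda>k. ((\<lambda>v. m *v v) ^^ k) u $ i) \<longlonglongrightarrow> 0 $ i"
        by (intro tendsto_vec_nth iterated_mean_matrix_tendsto_0 sr)
    qed simp
  qed
qed

section \<open>Subordinators at independent random times\<close>

text \<open>The truncation at \<open>4 ^ k\<close> makes the set of values finite; \<open>t < dyadic_above k t\<close> only
  holds for large \<open>k\<close>.\<close>

definition dyadic_above :: "nat \<Rightarrow> real \<Rightarrow> real" where
  "dyadic_above k t = (min (of_int \<lfloor>2 ^ k * t\<rfloor>) (4 ^ k) + 1) / 2 ^ k"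

definition dyadic_grid :: "nat \<Rightarrow> real set" where
  "dyadic_grid k = (\<lambda>j. (real j + 1) / 2 ^ k) ` {..4 ^ k}"

lemma finite_dyadic_grid: "finite (dyadic_grid k)"
  by (simp add: dyadic_grid_def)

lemma dyadic_grid_nonneg: "s \<in> dyadic_grid k \<Longrightarrow> 0 \<le> s"
  by (auto simp: dyadic_grid_def)

lemma dyadic_above_in_grid:
  assumes "0 \<le> t"
  shows "dyadic_above k t \<in> dyadic_grid k"
proof -
  define j where "j = min (nat \<lfloor>2 ^ k * t\<rfloor>) (4 ^ k)"
  have "real j = min (of_int \<lfloor>2 ^ k * t\<rfloor>) (4 ^ k)"
    using assms unfolding j_def of_nat_min by simp
  then show ?thesis
    unfolding dyadic_above_def dyadic_grid_def by (intro image_eqI[of _ _ j]) (auto simp: j_def)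
qed

lemma borel_measurable_dyadic_above [measurable]: "dyadic_above k \<in> borel_measurable borel"
  unfolding dyadic_above_def by measurable

text \<open>The approach must be from strictly above, because right-continuity speaks of
  \<open>at_right\<close>. Adding \<open>1\<close> to the floor provides the strict
  inequality.\<close>

lemma filterlim_dyadic_above:
  assumes "0 \<le> t"
  shows "filterlim (\<lambda>k. dyadic_above k t) (at_right t) sequentially"
proof -
  \<comment> \<open>Once \<open>t \<le> 2 ^ k\<close>, the product \<open>2 ^ k * t\<close> is at
    most \<open>4 ^ k\<close> and the truncation has no effect.\<close>
  have "\<forall>\<^sub>F k in sequentially. t \<le> 2 ^ k" by real_asymp
  then have ev: "\<forall>\<^sub>F k in sequentially. t < dyadic_above k t \<and> dyadic_above k t \<le> t + 1 / 2 ^ k"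
  proof eventually_elim
    case (elim k)
    have "2 ^ k * t \<le> 2 ^ k * 2 ^ k" using elim by (intro mult_left_mono) auto
    also have "\<dots> = 4 ^ k" by (simp flip: power_mult_distrib)
    finally have "of_int \<lfloor>2 ^ k * t\<rfloor> \<le> (4 :: real) ^ k" by linarith
    then have "dyadic_above k t * 2 ^ k = of_int \<lfloor>2 ^ k * t\<rfloor> + 1"
      by (simp add: dyadic_above_def min_def)
    moreover have "t * 2 ^ k < of_int \<lfloor>2 ^ k * t\<rfloor> + 1" by (simp add: mult.commute)
    moreover have "of_int \<lfloor>2 ^ k * t\<rfloor> + 1 \<le> t * 2 ^ k + 1" by (simp add: mult.commute)
    ultimately have "t * 2 ^ k < dyadic_above k t * 2 ^ k" "dyadic_above k t * 2 ^ k \<le> (t + 1 / 2 ^ k) * 2 ^ k"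
      by (simp_all add: distrib_right)
    then show ?case by simp
  qed
  have "(\<lambda>k. t + 1 / 2 ^ k) \<longlonglongrightarrow> t" by real_asymp
  then have "(\<lambda>k. dyadic_above k t) \<longlonglongrightarrow> t"
  proof (rule tendsto_sandwich[rotated 2, OF tendsto_const])
    show "\<forall>\<^sub>F k in sequentially. t \<le> dyadic_above k t"
      "\<forall>\<^sub>F k in sequentially. dyadic_above k t \<le> t + 1 / 2 ^ k"
      by (rule eventually_mono[OF ev], simp)+
  qed
  moreover have "\<forall>\<^sub>F k in sequentially. dyadic_above k t \<in> {t<..} \<and> dyadic_above k t \<noteq> t"
    using ev by (rule eventually_mono) simp
  ultimately show ?thesis by (simp add: filterlim_at)
qed

text \<open>Evaluation at a random grid time becomes a finite sum over deterministic times with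
  random weights. Measurability and the independence computation are both reduced to fixed times in
  this way.\<close>

lemma dyadic_above_expansion:
  fixes f :: "real \<Rightarrow> 'b::real_vector"
  assumes "0 \<le> t"
  shows "f (dyadic_above k t) = (\<Sum>s\<in>dyadic_grid k. indicat_real {s} (dyadic_above k t) *\<^sub>R f s)"
proof -
  have "(\<Sum>s\<in>dyadic_grid k. indicat_real {s} (dyadic_above k t) *\<^sub>R f s)
      = (\<Sum>s\<in>dyadic_grid k. if s = dyadic_above k t then f s else 0)"
    by (intro sum.cong) (auto simp: indicator_def)
  also have "\<dots> = f (dyadic_above k t)"
    using dyadic_above_in_grid[OF assms] by (simp add: finite_dyadic_grid)
  finally show ?thesis by simp
qed

text \<open>A pointwise limit along the dyadic times. \<open>N\<close> is arbitrary, since the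
  result is needed for the sigma-algebras generated by selected sources as well as for the whole
  space.\<close>

lemma borel_measurable_at_random_time:
  fixes X :: "real \<Rightarrow> 'a \<Rightarrow> 'b::euclidean_space"
  assumes T [measurable]: "T \<in> borel_measurable N" and pos: "\<And>\<omega>. \<omega> \<in> space N \<Longrightarrow> 0 \<le> T \<omega>"
    and X: "\<And>t. 0 \<le> t \<Longrightarrow> X t \<in> borel_measurable N"
    and right: "\<And>t \<omega>. 0 \<le> t \<Longrightarrow> \<omega> \<in> space N \<Longrightarrow> ((\<lambda>s. X s \<omega>) \<longlongrightarrow> X t \<omega>) (at_right t)"
  shows "(\<lambda>\<omega>. X (T \<omega>) \<omega>) \<in> borel_measurable N"
proof (rule borel_measurable_LIMSEQ_metric)
  fix k
  have "(\<lambda>\<omega>. \<Sum>s\<in>dyadic_grid k. indicat_real {s} (dyadic_above k (T \<omega>)) *\<^sub>R X s \<omega>) \<in> borel_measurable N"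
    using X[OF dyadic_grid_nonneg] by (intro borel_measurable_sum borel_measurable_scaleR) measurable
  then show "(\<lambda>\<omega>. X (dyadic_above k (T \<omega>)) \<omega>) \<in> borel_measurable N"
    by (rule measurable_cong[THEN iffD1, rotated])
      (rule dyadic_above_expansion[OF pos, symmetric])
next
  fix \<omega> assume "\<omega> \<in> space N"
  then show "(\<lambda>k. X (dyadic_above k (T \<omega>)) \<omega>) \<longlonglongrightarrow> X (T \<omega>) \<omega>"
    by (intro filterlim_compose[OF right filterlim_dyadic_above] pos)
qed

text \<open>\<open>N\<close> plays the role of a sigma-algebra of events that are independent of the process.\<close>

lemma (in levy_subordinator) expectation_exp_at_independent_time:
  assumes \<phi>: "laplace_exponent M X \<phi>" and u: "0 \<le> u"
    and T: "T \<in> borel_measurable M" and T_nonneg: "\<And>\<omega>. \<omega> \<in> space M \<Longrightarrow> 0 \<le> T \<omega>"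
    and Z: "Z \<in> borel_measurable M"
    and Z_bounds: "\<And>\<omega>. \<omega> \<in> space M \<Longrightarrow> 0 \<le> Z \<omega> \<and> Z \<omega> \<le> 1"
    and T_past: "T \<in> borel_measurable N" and Z_past: "Z \<in> borel_measurable N"
    and indep: "\<And>t (f :: 'a \<Rightarrow> real). 0 \<le> t \<Longrightarrow> f \<in> borel_measurable N \<Longrightarrow>
      indep_var borel f borel (\<lambda>\<omega>. exp (- (u \<bullet> X t \<omega>)))"
  shows "expectation (\<lambda>\<omega>. Z \<omega> * exp (- (u \<bullet> X (T \<omega>) \<omega>))) = expectation (\<lambda>\<omega>. Z \<omega> * exp (- T \<omega> * \<phi> u))"
proof -
  have \<phi>_nonneg: "0 \<le> \<phi> u"
    by (rule subadditive_exponent_nonneg[OF subadditive_exponent_laplace_exponent[OF \<phi>] u])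
  define Tk where "Tk k \<omega> = dyadic_above k (T \<omega>)" for k \<omega>
  \<comment> \<open>The weight attached to the grid value \<open>s\<close>; being measurable for
    \<open>N\<close>, it is independent of the process at time \<open>s\<close>.\<close>
  have past: "(\<lambda>\<omega>. indicat_real {s} (Tk k \<omega>) * Z \<omega>) \<in> borel_measurable N" for s k
    using T_past Z_past unfolding Tk_def by measurable
  note [measurable] = T Z
  have Tk_meas [measurable]: "Tk k \<in> borel_measurable M" for k unfolding Tk_def by measurable
  have Tk_nonneg: "0 \<le> Tk k \<omega>" if "\<omega> \<in> space M" for k \<omega>
    unfolding Tk_def by (rule dyadic_grid_nonneg[OF dyadic_above_in_grid[OF T_nonneg[OF that]]])
  have Tk_lim: "filterlim (\<lambda>k. Tk k \<omega>) (at_right (T \<omega>)) sequentially" if "\<omega> \<in> space M" for \<omega>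
    unfolding Tk_def by (rule filterlim_dyadic_above[OF T_nonneg[OF that]])
  have X_Tk: "(\<lambda>\<omega>. X (Tk k \<omega>) \<omega>) \<in> borel_measurable M" for k
    by (rule borel_measurable_at_random_time[OF Tk_meas Tk_nonneg measurable right_continuous])
  have X_T: "(\<lambda>\<omega>. X (T \<omega>) \<omega>) \<in> borel_measurable M"
    by (rule borel_measurable_at_random_time[OF T T_nonneg measurable right_continuous])
  have exp_meas: "(\<lambda>\<omega>. exp (- (u \<bullet> X (Tk k \<omega>) \<omega>))) \<in> borel_measurable M"
    "(\<lambda>\<omega>. exp (- (u \<bullet> X (T \<omega>) \<omega>))) \<in> borel_measurable M" for k
    using measurable_compose[OF X_Tk, of "\<lambda>x. exp (- (u \<bullet> x))"]
      measurable_compose[OF X_T, of "\<lambda>x. exp (- (u \<bullet> x))"] by auto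
  \<comment> \<open>The constant \<open>1\<close> dominates the integrands in both limits
    below.\<close>
  have le1: "\<bar>Z \<omega> * exp (- a)\<bar> \<le> 1" if "\<omega> \<in> space M" "0 \<le> a" for \<omega> a
    using Z_bounds[OF that(1)] that(2) by (auto simp: abs_mult intro!: mult_le_one)
  have exp_nonneg: "0 \<le> u \<bullet> X t \<omega>" if "0 \<le> t" "\<omega> \<in> space M" for t \<omega>
    using that by (intro inner_vec_nonneg u nonneg)
  have dyadic: "expectation (\<lambda>\<omega>. Z \<omega> * exp (- (u \<bullet> X (Tk k \<omega>) \<omega>)))
      = expectation (\<lambda>\<omega>. Z \<omega> * exp (- (Tk k \<omega> * \<phi> u)))" for k
  proof -
    define g where "g s \<omega> = indicat_real {s} (Tk k \<omega>) * Z \<omega>" for s \<omega>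
    have g_meas [measurable]: "g s \<in> borel_measurable M" for s unfolding g_def by measurable
    have g_int: "integrable M (g s)" for s
      by (rule integrable_const_bound[where B = 1])
        (use Z_bounds in \<open>auto simp: g_def indicator_def\<close>)
    have g_ind: "indep_var borel (g s) borel (\<lambda>\<omega>. exp (- (u \<bullet> X s \<omega>)))" if "0 \<le> s" for s
      unfolding g_def[abs_def] by (rule indep[OF that past])
    have expand: "Z \<omega> * f (Tk k \<omega>) = (\<Sum>s\<in>dyadic_grid k. g s \<omega> * f s)" if "\<omega> \<in> space M" for \<omega> and f :: "real \<Rightarrow> real"
      unfolding dyadic_above_expansion[OF T_nonneg[OF that], of f k, folded Tk_def]
      by (simp add: sum_distrib_left g_def mult_ac)
    have "expectation (\<lambda>\<omega>. Z \<omega> * exp (- (u \<bullet> X (Tk k \<omega>) \<omega>)))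
        = expectation (\<lambda>\<omega>. \<Sum>s\<in>dyadic_grid k. g s \<omega> * exp (- (u \<bullet> X s \<omega>)))"
      by (intro Bochner_Integration.integral_cong refl expand)
    also have "\<dots> = (\<Sum>s\<in>dyadic_grid k. expectation (\<lambda>\<omega>. g s \<omega> * exp (- (u \<bullet> X s \<omega>))))"
      using u by (intro Bochner_Integration.integral_sum indep_var_integrable g_ind g_int integrable_exp dyadic_grid_nonneg)
    also have "\<dots> = (\<Sum>s\<in>dyadic_grid k. expectation (g s) * exp (- (s * \<phi> u)))"
    proof (rule sum.cong[OF refl])
      fix s assume "s \<in> dyadic_grid k"
      then have s: "0 \<le> s" by (rule dyadic_grid_nonneg)
      have "expectation (\<lambda>\<omega>. g s \<omega> * exp (- (u \<bullet> X s \<omega>)))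
          = expectation (g s) * expectation (\<lambda>\<omega>. exp (- (u \<bullet> X s \<omega>)))"
        by (intro indep_var_lebesgue_integral g_ind g_int integrable_exp s u)
      also have "expectation (\<lambda>\<omega>. exp (- (u \<bullet> X s \<omega>))) = exp (- (s * \<phi> u))"
        using \<phi> s u by (auto simp: laplace_exponent_def laplace_def)
      finally show "expectation (\<lambda>\<omega>. g s \<omega> * exp (- (u \<bullet> X s \<omega>))) = expectation (g s) * exp (- (s * \<phi> u))" .
    qed
    also have "\<dots> = expectation (\<lambda>\<omega>. \<Sum>s\<in>dyadic_grid k. g s \<omega> * exp (- (s * \<phi> u)))"
      by (simp add: g_int)
    also have "\<dots> = expectation (\<lambda>\<omega>. Z \<omega> * exp (- (Tk k \<omega> * \<phi> u)))"
      by (intro Bochner_Integration.integral_cong refl expand[symmetric])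
    finally show ?thesis .
  qed
  \<comment> \<open>Both sides of \<open>dyadic\<close> converge to their counterparts at
    \<open>T\<close>: the left one by right-continuity of the paths, the right one by continuity of
    \<open>exp\<close>.\<close>
  have "(\<lambda>k. expectation (\<lambda>\<omega>. Z \<omega> * exp (- (u \<bullet> X (Tk k \<omega>) \<omega>))))
      \<longlonglongrightarrow> expectation (\<lambda>\<omega>. Z \<omega> * exp (- (u \<bullet> X (T \<omega>) \<omega>)))"
  proof (rule integral_dominated_convergence[where w = "\<lambda>_. 1"])
    show "AE \<omega> in M. (\<lambda>k. Z \<omega> * exp (- (u \<bullet> X (Tk k \<omega>) \<omega>))) \<longlonglongrightarrow> Z \<omega> * exp (- (u \<bullet> X (T \<omega>) \<omega>))"
      by (intro AE_I2 tendsto_intros filterlim_compose[OF right_continuous Tk_lim] T_nonneg)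
    show "AE \<omega> in M. norm (Z \<omega> * exp (- (u \<bullet> X (Tk k \<omega>) \<omega>))) \<le> 1" for k
      unfolding real_norm_def by (intro AE_I2 le1 exp_nonneg Tk_nonneg)
    show "(\<lambda>\<omega>. Z \<omega> * exp (- (u \<bullet> X (T \<omega>) \<omega>))) \<in> borel_measurable M"
      by (intro borel_measurable_times Z exp_meas)
    show "(\<lambda>\<omega>. Z \<omega> * exp (- (u \<bullet> X (Tk k \<omega>) \<omega>))) \<in> borel_measurable M" for k
      by (intro borel_measurable_times Z exp_meas)
  qed simp
  moreover have "(\<lambda>k. expectation (\<lambda>\<omega>. Z \<omega> * exp (- (Tk k \<omega> * \<phi> u))))
      \<longlonglongrightarrow> expectation (\<lambda>\<omega>. Z \<omega> * exp (- (T \<omega> * \<phi> u)))"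
  proof (rule integral_dominated_convergence[where w = "\<lambda>_. 1"])
    have "(\<lambda>k. Tk k \<omega>) \<longlonglongrightarrow> T \<omega>" if "\<omega> \<in> space M" for \<omega>
      using Tk_lim[OF that] by (simp add: filterlim_at)
    then show "AE \<omega> in M. (\<lambda>k. Z \<omega> * exp (- (Tk k \<omega> * \<phi> u))) \<longlonglongrightarrow> Z \<omega> * exp (- (T \<omega> * \<phi> u))"
      by (intro AE_I2 tendsto_intros)
    show "AE \<omega> in M. norm (Z \<omega> * exp (- (Tk k \<omega> * \<phi> u))) \<le> 1" for k
      unfolding real_norm_def by (intro AE_I2 le1 mult_nonneg_nonneg \<phi>_nonneg Tk_nonneg)
    show "(\<lambda>\<omega>. Z \<omega> * exp (- (T \<omega> * \<phi> u))) \<in> borel_measurable M"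
      "(\<lambda>\<omega>. Z \<omega> * exp (- (Tk k \<omega> * \<phi> u))) \<in> borel_measurable M" for k
      by measurable
  qed simp
  ultimately have "expectation (\<lambda>\<omega>. Z \<omega> * exp (- (u \<bullet> X (T \<omega>) \<omega>))) = expectation (\<lambda>\<omega>. Z \<omega> * exp (- (T \<omega> * \<phi> u)))"
    unfolding dyadic by (rule LIMSEQ_unique)
  then show ?thesis by simp
qed

section \<open>Transforms over one cycle\<close>

lemma borel_measurable_exp_inner:
  fixes X :: "'a \<Rightarrow> 'b::euclidean_space"
  assumes "X \<in> borel_measurable N"
  shows "(\<lambda>\<omega>. exp (- (u \<bullet> X \<omega>))) \<in> borel_measurable N"
  using assms by measurable

text \<open>The integral of a strictly positive function over a probability space cannot vanish.
  Positivity later permits division by transforms and excludes a vanishing infinite product.\<close>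

lemma laplace_pos:
  fixes X :: "'a \<Rightarrow> 'b::euclidean_space"
  assumes M: "prob_space M" and X: "X \<in> borel_measurable M" and pos: "AE \<omega> in M. 0 \<le> u \<bullet> X \<omega>"
  shows "0 < laplace M X u"
proof -
  interpret prob_space M by (rule M)
  have int: "integrable M (\<lambda>\<omega>. exp (- (u \<bullet> X \<omega>)))"
    by (rule integrable_const_bound[where B = 1]) (use pos borel_measurable_exp_inner[OF X] in auto)
  have "expectation (\<lambda>\<omega>. exp (- (u \<bullet> X \<omega>))) \<noteq> 0"
    using integral_nonneg_eq_0_iff_AE[OF int] by (simp add: AE_False)
  moreover have "0 \<le> expectation (\<lambda>\<omega>. exp (- (u \<bullet> X \<omega>)))" by simp
  ultimately show ?thesis unfolding laplace_def by linarith
qed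

lemma laplace_distr:
  fixes X :: "'a \<Rightarrow> 'b::euclidean_space"
  assumes "X \<in> borel_measurable M"
  shows "laplace (distr M borel X) (\<lambda>x. x) u = laplace M X u"
  unfolding laplace_def using assms by (intro integral_distr borel_measurable_exp_inner) simp_all

lemma borel_measurable_vec_nth:
  fixes X :: "'a \<Rightarrow> real ^ 'n"
  assumes "X \<in> borel_measurable N"
  shows "(\<lambda>\<omega>. X \<omega> $ i) \<in> borel_measurable N"
proof -
  have "(\<lambda>\<omega>. X \<omega> \<bullet> axis i 1) \<in> borel_measurable N" using assms by measurable
  then show ?thesis by (simp add: inner_axis)
qed

lemma sigma_algebra_generated: "sigma_algebra (space M) (generated M F)"
  unfolding generated_def by (rule sigma_algebra_sigma_sets) auto

section \<open>The cyclic order of the queues\<close>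

lemma first_queue_le: "first_queue \<le> (i :: 'n::{finite, linorder})"
  and le_last_queue: "i \<le> last_queue"
  by (intro Min_le Max_ge; simp)+

lemma next_queue_predecessor:
  fixes i :: "'n::{finite, linorder}"
  assumes "i \<noteq> first_queue"
  obtains p where "p \<noteq> last_queue" "next_queue p = i" "{j. j < i} = insert p {j. j < p}" "p < i"
proof
  let ?L = "{j. j < i}"
  define p where "p = Max ?L"
  have "first_queue \<in> ?L" using assms first_queue_le[of i] by (simp add: less_le)
  then have ne: "?L \<noteq> {}" by blast
  have p: "p \<in> ?L" unfolding p_def using ne by (intro Max_in) auto
  have max: "j \<le> p" if "j < i" for j unfolding p_def using that by (intro Max_ge) auto
  show "p < i" using p by simp
  then show last: "p \<noteq> last_queue" using le_last_queue[of i] by auto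
  show "{j. j < i} = insert p {j. j < p}" using p max by (auto simp: order_le_less)
  have "Min {j. p < j} = i"
    using p max by (intro Min_eqI) (auto simp: not_less[symmetric])
  then show "next_queue p = i" using last by (simp add: next_queue_def)
qed

text \<open>Induction along the server's route within one cycle: every queue but the first has an
  immediate predecessor.\<close>

lemma queue_induct_up [case_names first step]:
  fixes i :: "'n::{finite, linorder}"
  assumes first: "Q first_queue" and step: "\<And>i. i \<noteq> last_queue \<Longrightarrow> Q i \<Longrightarrow> Q (next_queue i)"
  shows "Q i"
proof (induction "card {j. j < i}" arbitrary: i rule: less_induct)
  case less
  show ?case
  proof (cases "i = first_queue")
    case False
    then obtain p where p: "p \<noteq> last_queue" "next_queue p = i" "{j. j < i} = insert p {j. j < p}" "p < i"
      by (rule next_queue_predecessor)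
    have "card {j. j < p} < card {j. j < i}" unfolding p(3) by simp
    then show ?thesis using step[OF p(1) less] p(2) by simp
  qed (use first in simp)
qed

text \<open>No queue lies strictly between \<open>i\<close> and its successor, so the queues before
  the next one are exactly those visited so far.\<close>

lemma less_next_queue_iff:
  fixes i :: "'n::{finite, linorder}"
  assumes "i \<noteq> last_queue"
  shows "j < next_queue i \<longleftrightarrow> j \<le> i"
proof -
  have "last_queue \<in> {j. i < j}" using assms le_last_queue[of i] by (simp add: less_le)
  then have ne: "{j. i < j} \<noteq> {}" by blast
  then have "j < Min {j. i < j} \<longleftrightarrow> (\<forall>k. i < k \<longrightarrow> j < k)" by simp
  also have "\<dots> \<longleftrightarrow> j \<le> i"
    by (metis less_irrefl not_less order_le_less_trans)
  finally show ?thesis using assms by (simp add: next_queue_def)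
qed

text \<open>Names the family whose independence is assumed in \<open>polling_system\<close>, so that
  single members and unions over sets of sources can be formed.\<close>

definition source_algebra ::
  "'a measure \<Rightarrow> (nat \<Rightarrow> 'n::{finite, linorder} \<Rightarrow> 'a \<Rightarrow> 'n rvec) \<Rightarrow>
   (nat \<Rightarrow> 'n \<Rightarrow> real \<Rightarrow> 'a \<Rightarrow> 'n rvec) \<Rightarrow> (nat \<Rightarrow> 'n \<Rightarrow> real \<Rightarrow> 'a \<Rightarrow> 'n rvec) \<Rightarrow>
   (nat \<Rightarrow> 'n \<Rightarrow> real \<Rightarrow> 'a \<Rightarrow> 'n rvec) \<Rightarrow> (nat \<Rightarrow> 'n \<Rightarrow> 'a \<Rightarrow> real) \<Rightarrow> 'n source \<Rightarrow> 'a set set" where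
  "source_algebra M X A H W S s = (case s of
        Initial \<Rightarrow> generated M {X 0 first_queue}
      | Visit n i \<Rightarrow> generated M (A n i ` {0..} \<union> H n i ` {0..})
      | Input n i \<Rightarrow> generated M (W n i ` {0..})
      | Switch n i \<Rightarrow> generated M {S n i})"

text \<open>The randomness consumed when the server reaches queue \<open>i\<close> in cycle
  \<open>n\<close>; pairs of cycle and queue are ordered lexicographically.\<close>

definition sources_before :: "nat \<Rightarrow> 'n::linorder \<Rightarrow> 'n source set" where
  "sources_before n i = insert Initial
     {s. \<exists>k j. (k < n \<or> k = n \<and> j < i) \<and> s \<in> {Visit k j, Input k j, Switch k j}}"

section \<open>Measurability and independence with respect to sets of sources\<close>

context polling_system
begin

abbreviation source_events :: "'n source \<Rightarrow> 'a set set" where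
  "source_events \<equiv> source_algebra M X A H W S"

text \<open>Encoded as a measure so that \<open>borel_measurable (known K)\<close> expresses being
  determined by the sources in \<open>K\<close>; only its space and its sets matter.\<close>

definition known :: "'n source set \<Rightarrow> 'a measure" where
  "known K = sigma (space M) (\<Union>s\<in>K. source_events s)"

lemma indep_source_events: "indep_sets source_events UNIV"
  using independence unfolding source_algebra_def .

lemma source_events_subset: "source_events s \<subseteq> events"
  using indep_source_events by (auto simp: indep_sets_def)

lemma sigma_algebra_source_events: "sigma_algebra (space M) (source_events s)"
  unfolding source_algebra_def by (cases s) (simp_all add: sigma_algebra_generated)

lemma space_known [simp]: "space (known K) = space M"
  by (simp add: known_def space_measure_of_conv)

lemma sets_known: "sets (known K) = sigma_sets (space M) (\<Union>s\<in>K. source_events s)"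
  unfolding known_def using source_events_subset sets.space_closed by (intro sets_measure_of) blast

lemma measurable_known_mono:
  assumes "f \<in> measurable (known K) N" "K \<subseteq> L"
  shows "f \<in> measurable (known L) N"
proof -
  have "sets (known K) \<subseteq> sets (known L)"
    unfolding sets_known using assms(2) by (intro sigma_sets_mono') auto
  then show ?thesis using assms(1) by (auto simp: measurable_def)
qed

lemma measurable_known:
  assumes "f \<in> measurable (known K) N"
  shows "f \<in> measurable M N"
proof -
  have "sets (known K) \<subseteq> events"
    unfolding sets_known using source_events_subset by (intro sets.sigma_sets_subset) blast
  then show ?thesis using assms by (auto simp: measurable_def)
qed

lemma measurable_knownI:
  fixes f :: "'a \<Rightarrow> 'c::topological_space"
  assumes "generated M F = source_events s" "f \<in> F" "s \<in> K"
  shows "f \<in> borel_measurable (known K)"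
proof (rule measurableI)
  fix B :: "'c set" assume "B \<in> sets borel"
  then have "f -` B \<inter> space M \<in> generated M F"
    unfolding generated_def using assms(2) by (intro sigma_sets.Basic) blast
  then show "f -` B \<inter> space (known K) \<in> sets (known K)"
    unfolding sets_known space_known using assms(1,3) by (intro sigma_sets.Basic) blast
qed simp

text \<open>Disjoint groups of independent sigma-algebras generate independent sigma-algebras,
  because each member is stable under intersection. Every use of independence below takes this
  form.\<close>

lemma indep_var_known:
  fixes f g :: "'a \<Rightarrow> 'c"
  assumes f: "f \<in> measurable (known K) N" and g: "g \<in> measurable (known L) N'" and KL: "K \<inter> L = {}"
  shows "indep_var N f N' g"
proof -
  have "indep_sets (\<lambda>b. sigma_sets (space M) (\<Union>s\<in>case_bool K L b. source_events s)) UNIV"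
  proof (rule indep_sets_collect_sigma)
    show "indep_sets source_events (\<Union>b\<in>UNIV. case_bool K L b)"
      by (rule indep_sets_mono_index[OF _ indep_source_events]) simp
    show "Int_stable (source_events s)" for s
    proof -
      interpret sigma_algebra "space M" "source_events s" by (rule sigma_algebra_source_events)
      show ?thesis by (auto simp: Int_stable_def)
    qed
    show "disjoint_family_on (case_bool K L) UNIV"
      using KL by (auto simp: disjoint_family_on_def split: bool.splits)
  qed
  then have "indep_sets (\<lambda>b. sets (known (case_bool K L b))) UNIV"
    by (simp only: sets_known)
  then have "indep_set (sigma_sets (space M) {f -` B \<inter> space M | B. B \<in> sets N})
      (sigma_sets (space M) {g -` B \<inter> space M | B. B \<in> sets N'})"
    unfolding indep_set_def
  proof (rule indep_sets_mono_sets)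
    fix b :: bool
    have "sigma_sets (space M) {h -` B \<inter> space M | B. B \<in> sets R} \<subseteq> sets (known J)"
      if h: "h \<in> measurable (known J) R" for h J and R :: "'c measure"
    proof -
      have "{h -` B \<inter> space (known J) | B. B \<in> sets R} \<subseteq> sets (known J)"
        using measurable_sets[OF h] by blast
      from sets.sigma_sets_subset[OF this] show ?thesis by simp
    qed
    then show "case_bool (sigma_sets (space M) {f -` B \<inter> space M | B. B \<in> sets N})
        (sigma_sets (space M) {g -` B \<inter> space M | B. B \<in> sets N'}) b \<subseteq> sets (known (case_bool K L b))"
      using f g by (cases b) auto
  qed
  then show ?thesis
    unfolding indep_var_eq using measurable_known[OF f] measurable_known[OF g] by simp
qed

lemma initial_known: "Initial \<in> K \<Longrightarrow> X 0 first_queue \<in> borel_measurable (known K)"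
  by (rule measurable_knownI[where s = Initial and F = "{X 0 first_queue}"]) (simp_all add: source_algebra_def)

lemma replacement_known: "Visit n i \<in> K \<Longrightarrow> 0 \<le> t \<Longrightarrow> H n i t \<in> borel_measurable (known K)"
  by (rule measurable_knownI[where s = "Visit n i" and F = "A n i ` {0..} \<union> H n i ` {0..}"])
    (simp_all add: source_algebra_def)

lemma input_known: "Input n i \<in> K \<Longrightarrow> 0 \<le> t \<Longrightarrow> W n i t \<in> borel_measurable (known K)"
  by (rule measurable_knownI[where s = "Input n i" and F = "W n i ` {0..}"])
    (simp_all add: source_algebra_def)

lemma switch_known: "Switch n i \<in> K \<Longrightarrow> S n i \<in> borel_measurable (known K)"
  by (rule measurable_knownI[where s = "Switch n i" and F = "{S n i}"]) (simp_all add: source_algebra_def)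

lemma subadditive_exponent_input: "subadditive_exponent \<phi>"
  by (rule levy_subordinator.subadditive_exponent_laplace_exponent[OF input])

lemma subadditive_exponent_replacement: "subadditive_exponent (\<eta> i)"
  by (rule levy_subordinator.subadditive_exponent_laplace_exponent[OF replacement])

section \<open>The workload along the server's route\<close>

lemma remaining_nonneg:
  fixes x :: "'n rvec"
  assumes "0 \<le> x"
  shows "0 \<le> x - (x $ i) *\<^sub>R axis i 1"
  using assms by (simp add: Finite_Cartesian_Product.less_eq_vec_def axis_def)

text \<open>\<open>branching\<close> expresses \<open>Y\<close> through \<open>X\<close> and the
  replacement process at the random time \<open>X n i \<omega> $ i\<close>, so only the source of
  the current visit is added. Non-negativity of \<open>X\<close> makes that time admissible.\<close>

lemma visit_end:
  assumes X: "X n i \<in> borel_measurable (known (sources_before n i))"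
    and pos: "\<And>\<omega>. \<omega> \<in> space M \<Longrightarrow> 0 \<le> X n i \<omega>"
  shows "Y n i \<in> borel_measurable (known (insert (Visit n i) (sources_before n i)))"
    and "\<omega> \<in> space M \<Longrightarrow> 0 \<le> Y n i \<omega>"
proof -
  interpret H: levy_subordinator M "H n i" by (rule replacement)
  let ?K = "known (insert (Visit n i) (sources_before n i))"
  have X': "X n i \<in> borel_measurable ?K" by (rule measurable_known_mono[OF X]) auto
  have Xi: "(\<lambda>\<omega>. X n i \<omega> $ i) \<in> borel_measurable ?K" by (rule borel_measurable_vec_nth[OF X'])
  have Xi_nonneg: "0 \<le> X n i \<omega> $ i" if "\<omega> \<in> space M" for \<omega>
    using pos[OF that] by (simp add: Finite_Cartesian_Product.less_eq_vec_def)
  have "(\<lambda>\<omega>. H n i (X n i \<omega> $ i) \<omega>) \<in> borel_measurable ?K"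
    by (rule borel_measurable_at_random_time[OF Xi])
      (simp_all add: Xi_nonneg replacement_known H.right_continuous)
  then have "(\<lambda>\<omega>. X n i \<omega> - (X n i \<omega> $ i) *\<^sub>R axis i 1 + H n i (X n i \<omega> $ i) \<omega>) \<in> borel_measurable ?K"
    by (intro borel_measurable_add borel_measurable_diff borel_measurable_scaleR X' Xi) simp_all
  then show "Y n i \<in> borel_measurable ?K"
    by (rule measurable_cong[THEN iffD1, rotated]) (simp add: branching)
  show "0 \<le> Y n i \<omega>" if "\<omega> \<in> space M"
    unfolding branching[OF that]
    using that by (intro add_nonneg_nonneg remaining_nonneg pos H.nonneg Xi_nonneg)
qed

lemma switch_end:
  assumes Y: "Y n i \<in> borel_measurable (known (insert (Visit n i) (sources_before n i)))"
    and pos: "\<And>\<omega>. \<omega> \<in> space M \<Longrightarrow> 0 \<le> Y n i \<omega>"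
    and n': "n' = (if i = last_queue then Suc n else n)"
  shows "X n' (next_queue i) \<in>
      borel_measurable (known (sources_before n i \<union> {Visit n i, Input n i, Switch n i}))"
    and "\<omega> \<in> space M \<Longrightarrow> 0 \<le> X n' (next_queue i) \<omega>"
proof -
  interpret W: levy_subordinator M "W n i" by (rule input)
  let ?K = "known (sources_before n i \<union> {Visit n i, Input n i, Switch n i})"
  have Y': "Y n i \<in> borel_measurable ?K" by (rule measurable_known_mono[OF Y]) auto
  have S: "S n i \<in> borel_measurable ?K" by (rule switch_known) simp
  have "(\<lambda>\<omega>. W n i (S n i \<omega>) \<omega>) \<in> borel_measurable ?K"
    by (rule borel_measurable_at_random_time[OF S])
      (simp_all add: less_imp_le switch_pos input_known W.right_continuous)
  then have "(\<lambda>\<omega>. Y n i \<omega> + W n i (S n i \<omega>) \<omega>) \<in> borel_measurable ?K"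
    by (intro borel_measurable_add Y')
  then show "X n' (next_queue i) \<in> borel_measurable ?K"
    by (rule measurable_cong[THEN iffD1, rotated]) (simp only: space_known n' switch_over)
  show "0 \<le> X n' (next_queue i) \<omega>" if "\<omega> \<in> space M"
    unfolding n' switch_over[OF that]
    using that switch_pos[OF that, of n i] by (intro add_nonneg_nonneg pos W.nonneg) auto
qed

lemma sources_before_next_queue:
  "sources_before n i \<union> {Visit n i, Input n i, Switch n i}
    \<subseteq> sources_before (if i = last_queue then Suc n else n) (next_queue i)"
  by (auto simp: sources_before_def less_Suc_eq less_next_queue_iff)

lemma visit_begin_step:
  assumes "X n i \<in> borel_measurable (known (sources_before n i)) \<and> (\<forall>\<omega>\<in>space M. 0 \<le> X n i \<omega>)"
    and n': "n' = (if i = last_queue then Suc n else n)"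
  shows "X n' (next_queue i) \<in> borel_measurable (known (sources_before n' (next_queue i))) \<and>
    (\<forall>\<omega>\<in>space M. 0 \<le> X n' (next_queue i) \<omega>)"
proof -
  have X: "X n i \<in> borel_measurable (known (sources_before n i))" using assms(1) ..
  have pos: "0 \<le> X n i \<omega>" if "\<omega> \<in> space M" for \<omega> using assms(1) that by blast
  have Y: "Y n i \<in> borel_measurable (known (insert (Visit n i) (sources_before n i)))"
    by (rule visit_end(1)[OF X]) (rule pos)
  have Y_nonneg: "0 \<le> Y n i \<omega>" if "\<omega> \<in> space M" for \<omega>
    by (rule visit_end(2)[OF X _ that]) (rule pos)
  have "X n' (next_queue i) \<in>
      borel_measurable (known (sources_before n i \<union> {Visit n i, Input n i, Switch n i}))"
    by (rule switch_end(1)[OF Y _ n']) (rule Y_nonneg)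
  then have "X n' (next_queue i) \<in> borel_measurable (known (sources_before n' (next_queue i)))"
    by (rule measurable_known_mono) (unfold n', rule sources_before_next_queue)
  moreover have "0 \<le> X n' (next_queue i) \<omega>" if "\<omega> \<in> space M" for \<omega>
    by (rule switch_end(2)[OF Y _ n' that]) (rule Y_nonneg)
  ultimately show ?thesis by blast
qed

text \<open>Measurability and non-negativity are carried together, since a workload coordinate
  serves as the time at which the replacement process is evaluated.\<close>

lemma visit_begin:
  "X n i \<in> borel_measurable (known (sources_before n i)) \<and> (\<forall>\<omega>\<in>space M. 0 \<le> X n i \<omega>)"
proof (induction n arbitrary: i)
  case 0
  show ?case
  proof (induction i rule: queue_induct_up)
    case first
    show ?case using initial_known initial_nonneg by (simp add: sources_before_def)
  next
    case (step i)
    then show ?case by (intro visit_begin_step) simp_all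
  qed
next
  case (Suc n)
  show ?case
  proof (induction i rule: queue_induct_up)
    case first
    \<comment> \<open>After the last queue comes the first one, whose visit belongs to cycle
      \<open>Suc n\<close>.\<close>
    have "next_queue last_queue = (first_queue :: 'n)" by (simp add: next_queue_def)
    then show ?case using visit_begin_step[OF Suc.IH[of last_queue] refl] by simp
  next
    case (step i)
    then show ?case by (intro visit_begin_step) simp_all
  qed
qed

lemma visit_begin_known: "X n i \<in> borel_measurable (known (sources_before n i))"
  and visit_begin_nonneg: "\<omega> \<in> space M \<Longrightarrow> 0 \<le> X n i \<omega>"
  using visit_begin by auto

lemma visit_end_known: "Y n i \<in> borel_measurable (known (insert (Visit n i) (sources_before n i)))"
  by (rule visit_end(1)[OF visit_begin_known]) (rule visit_begin_nonneg)

lemma visit_end_nonneg: "\<omega> \<in> space M \<Longrightarrow> 0 \<le> Y n i \<omega>"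
  by (rule visit_end(2)[OF visit_begin_known _]) (rule visit_begin_nonneg)

section \<open>Transforms across a visit, a switch-over period and a cycle\<close>

lemma Visit_notin_sources_before: "Visit n i \<notin> sources_before n i"
  and Input_notin_sources_before: "Input n i \<notin> sources_before n i"
  and Switch_notin_sources_before: "Switch n i \<notin> sources_before n i"
  by (auto simp: sources_before_def)

lemma laplace_switch_law: "laplace (\<sigma> i) (\<lambda>s. s) v = laplace M (S n i) v"
  unfolding switch_law[of n i, symmetric] by (rule laplace_distr[OF switch_measurable])

lemma exp_inner_le_1:
  fixes u x :: "'n rvec"
  assumes "0 \<le> u" "0 \<le> x"
  shows "exp (- (u \<bullet> x)) \<le> 1"
  using inner_vec_nonneg[OF assms] by simp

text \<open>The fluid \<open>T\<close> in queue \<open>i\<close> is the time of the replacement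
  process, and \<open>Z\<close> is the factor of the other queues. Both are determined before the
  visit, hence independent of \<open>H n i\<close>; averaging over \<open>H n i\<close> leaves
  \<open>exp (- T \<omega> * \<eta> i u)\<close>.\<close>

lemma laplace_visit_end:
  assumes u: "0 \<le> u"
  shows "laplace M (Y n i) u = laplace M (X n i) (\<chi> j. if j = i then \<eta> i u else u $ j)"
proof -
  interpret H: levy_subordinator M "H n i" by (rule replacement)
  define T where "T \<omega> = X n i \<omega> $ i" for \<omega>
  define Z where "Z \<omega> = exp (- (u \<bullet> (X n i \<omega> - (X n i \<omega> $ i) *\<^sub>R axis i 1)))" for \<omega>
  have T: "T \<in> borel_measurable (known (sources_before n i))"
    unfolding T_def by (rule borel_measurable_vec_nth[OF visit_begin_known])
  have "(\<lambda>\<omega>. X n i \<omega> - T \<omega> *\<^sub>R axis i 1) \<in> borel_measurable (known (sources_before n i))"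
    by (intro borel_measurable_diff borel_measurable_scaleR visit_begin_known T) simp
  then have Z: "Z \<in> borel_measurable (known (sources_before n i))"
    unfolding Z_def T_def by (rule borel_measurable_exp_inner)
  have "laplace M (Y n i) u = expectation (\<lambda>\<omega>. Z \<omega> * exp (- (u \<bullet> H n i (T \<omega>) \<omega>)))"
    unfolding laplace_def Z_def T_def
    by (intro Bochner_Integration.integral_cong refl)
      (simp add: branching inner_add_right flip: exp_add)
  also have "\<dots> = expectation (\<lambda>\<omega>. Z \<omega> * exp (- T \<omega> * \<eta> i u))"
  proof (rule H.expectation_exp_at_independent_time[OF replacement(2) u _ _ _ _ T Z])
    show "T \<in> borel_measurable M" "Z \<in> borel_measurable M"
      using T Z by (auto intro: measurable_known)
    show "0 \<le> T \<omega>" "0 \<le> Z \<omega> \<and> Z \<omega> \<le> 1" if "\<omega> \<in> space M" for \<omega>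
      using visit_begin_nonneg[OF that, of n i] exp_inner_le_1[OF u remaining_nonneg]
      by (simp_all add: T_def Z_def Finite_Cartesian_Product.less_eq_vec_def)
    fix t :: real and f :: "'a \<Rightarrow> real"
    assume t: "0 \<le> t" and f: "f \<in> borel_measurable (known (sources_before n i))"
    have "H n i t \<in> borel_measurable (known {Visit n i})" using t by (simp add: replacement_known)
    then show "indep_var borel f borel (\<lambda>\<omega>. exp (- (u \<bullet> H n i t \<omega>)))"
      by (intro indep_var_known[OF f borel_measurable_exp_inner]) (auto simp: Visit_notin_sources_before)
  qed
  also have "\<dots> = laplace M (X n i) (\<chi> j. if j = i then \<eta> i u else u $ j)"
  proof -
    have "exp (- a) * exp (- t * b) = exp (- (a + b * t))" for a b t :: real
      by (simp add: mult.commute flip: exp_add)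
    then show ?thesis
      unfolding laplace_def inner_expansion_coordinate[symmetric] Z_def T_def by (simp only:)
  qed
  finally show ?thesis .
qed

text \<open>Independence is used twice: \<open>W n i\<close> is independent of the workload together
  with the duration, which turns the input into \<open>exp (- S n i \<omega> * \<phi> u)\<close>;
  then the duration is independent of the workload, which factorizes the expectation.\<close>

lemma laplace_switch_end:
  assumes u: "0 \<le> u"
  shows "laplace M (X (if i = last_queue then Suc n else n) (next_queue i)) u
    = laplace M (Y n i) u * laplace (\<sigma> i) (\<lambda>s. s) (\<phi> u)"
proof -
  interpret W: levy_subordinator M "W n i" by (rule input)
  define Z where "Z \<omega> = exp (- (u \<bullet> Y n i \<omega>))" for \<omega>
  \<comment> \<open>\<open>?K'\<close> contains the switch source because the duration is the
    evaluation time; \<open>?K\<close> omits it so that the final factorization is possible.\<close>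
  let ?K = "insert (Visit n i) (sources_before n i)" and ?K' = "{Visit n i, Switch n i} \<union> sources_before n i"
  have \<phi>: "0 \<le> \<phi> u" by (rule subadditive_exponent_nonneg[OF subadditive_exponent_input u])
  have Z: "Z \<in> borel_measurable (known ?K)"
    unfolding Z_def by (rule borel_measurable_exp_inner[OF visit_end_known])
  have Z': "Z \<in> borel_measurable (known ?K')" by (rule measurable_known_mono[OF Z]) auto
  have S: "S n i \<in> borel_measurable (known {Switch n i})" by (rule switch_known) simp
  have S': "S n i \<in> borel_measurable (known ?K')" by (rule switch_known) simp
  have Z_bounds: "0 \<le> Z \<omega> \<and> Z \<omega> \<le> 1" if "\<omega> \<in> space M" for \<omega>
    using exp_inner_le_1[OF u visit_end_nonneg[OF that]] by (simp add: Z_def)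
  have exp_S: "(\<lambda>\<omega>. exp (- S n i \<omega> * \<phi> u)) \<in> borel_measurable (known {Switch n i})"
    using S by measurable
  have "laplace M (X (if i = last_queue then Suc n else n) (next_queue i)) u
      = expectation (\<lambda>\<omega>. Z \<omega> * exp (- (u \<bullet> W n i (S n i \<omega>) \<omega>)))"
    unfolding laplace_def Z_def
    by (intro Bochner_Integration.integral_cong refl)
      (simp only: switch_over inner_add_right minus_add_distrib exp_add)
  also have "\<dots> = expectation (\<lambda>\<omega>. Z \<omega> * exp (- S n i \<omega> * \<phi> u))"
  proof (rule W.expectation_exp_at_independent_time[OF input(2) u switch_measurable _ _ _ S' Z'])
    show "Z \<in> borel_measurable M" by (rule measurable_known[OF Z])
    show "0 \<le> S n i \<omega>" "0 \<le> Z \<omega> \<and> Z \<omega> \<le> 1" if "\<omega> \<in> space M" for \<omega>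
      using switch_pos[OF that, of n i] Z_bounds[OF that] by simp_all
    fix t :: real and f :: "'a \<Rightarrow> real"
    assume t: "0 \<le> t" and f: "f \<in> borel_measurable (known ?K')"
    have "W n i t \<in> borel_measurable (known {Input n i})" using t by (simp add: input_known)
    then show "indep_var borel f borel (\<lambda>\<omega>. exp (- (u \<bullet> W n i t \<omega>)))"
      by (intro indep_var_known[OF f borel_measurable_exp_inner]) (auto simp: Input_notin_sources_before)
  qed
  also have "\<dots> = expectation Z * expectation (\<lambda>\<omega>. exp (- S n i \<omega> * \<phi> u))"
  proof (rule indep_var_lebesgue_integral)
    show "indep_var borel Z borel (\<lambda>\<omega>. exp (- S n i \<omega> * \<phi> u))"
      by (rule indep_var_known[OF Z exp_S]) (simp add: Switch_notin_sources_before)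
    show "integrable M Z"
      by (rule integrable_const_bound[where B = 1]) (use Z_bounds measurable_known[OF Z] in auto)
    show "integrable M (\<lambda>\<omega>. exp (- S n i \<omega> * \<phi> u))"
      by (rule integrable_const_bound[where B = 1, OF _ measurable_known[OF exp_S]])
        (auto intro!: AE_I2 mult_nonneg_nonneg \<phi> less_imp_le[OF switch_pos])
  qed
  also have "\<dots> = laplace M (Y n i) u * laplace (\<sigma> i) (\<lambda>s. s) (\<phi> u)"
    unfolding laplace_switch_law[of i _ n] by (simp add: laplace_def Z_def[abs_def] mult.commute)
  finally show ?thesis .
qed

text \<open>The cycle is traversed with a moving argument: \<open>v i\<close> on arrival at queue
  \<open>i\<close>, \<open>w i\<close> at the end of that visit and after the switch-over. Queues
  already visited carry \<open>u\<close>, the others \<open>kappa \<eta> u\<close>, so the argument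
  runs from \<open>kappa \<eta> u\<close> at the first arrival to \<open>u\<close> at the end of the
  cycle.\<close>

lemma laplace_cycle:
  assumes u: "0 \<le> u"
  shows "laplace M (X (Suc n) first_queue) u = G_transform \<phi> \<eta> \<sigma> u * laplace M (X n first_queue) (kappa \<eta> u)"
proof -
  define v where "v i = (\<chi> j. if j < i then u $ j else kappa \<eta> u $ j)" for i
  define w where "w i = (\<chi> j. if j \<le> i then u $ j else kappa \<eta> u $ j)" for i
  define g where "g i = laplace (\<sigma> i) (\<lambda>s. s) (\<phi> (w i))" for i
  have w: "0 \<le> w i" for i
    using u kappa_nonneg[of \<eta>, OF subadditive_exponent_replacement u]
    by (simp add: w_def Finite_Cartesian_Product.less_eq_vec_def)
  \<comment> \<open>The recursion for \<open>kappa\<close> is exactly what turns \<open>w i\<close>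
    into \<open>v i\<close>: the two differ only in coordinate \<open>i\<close>.\<close>
  have "\<eta> i (w i) = kappa \<eta> u $ i" for i unfolding w_def by (rule kappa_nth[symmetric])
  then have "(\<chi> j. if j = i then \<eta> i (w i) else w i $ j) = v i" for i
    by (auto simp: v_def w_def Finite_Cartesian_Product.vec_eq_iff)
  then have switch_step: "laplace M (X (if i = last_queue then Suc n else n) (next_queue i)) (w i)
      = g i * laplace M (X n i) (v i)" for i
    unfolding laplace_switch_end[OF w] laplace_visit_end[OF w] by (simp add: g_def)
  have prefix: "laplace M (X n i) (v i) = (\<Prod>j\<in>{j. j < i}. g j) * laplace M (X n first_queue) (kappa \<eta> u)" for i
  proof (induction i rule: queue_induct_up)
    case first
    have "\<not> j < first_queue" for j :: 'n using first_queue_le[of j] by (simp only: not_less)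
    then have "{j :: 'n. j < first_queue} = {}" "v first_queue = kappa \<eta> u"
      by (blast, simp only: v_def if_False vec_lambda_eta)
    then show ?case by (simp only: prod.empty mult_1)
  next
    case (step i)
    have "{j. j < next_queue i} = insert i {j. j < i}"
      unfolding less_next_queue_iff[OF step(1)] order_le_less by blast
    moreover have "v (next_queue i) = w i"
      by (simp only: v_def w_def less_next_queue_iff[OF step(1)])
    moreover have "laplace M (X n (next_queue i)) (w i) = g i * laplace M (X n i) (v i)"
      using switch_step[of i] step(1) by (simp only: if_False)
    moreover have "(\<Prod>j\<in>insert i {j. j < i}. g j) = g i * (\<Prod>j\<in>{j. j < i}. g j)"
      by (rule prod.insert) simp_all
    ultimately show ?case by (simp only: step(2) mult.assoc)
  qed
  have "laplace M (X (Suc n) first_queue) u = laplace M (X (Suc n) (next_queue last_queue)) (w last_queue)"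
    by (simp only: next_queue_def w_def le_last_queue refl if_True vec_lambda_eta)
  also have "\<dots> = (g last_queue * (\<Prod>j\<in>{j. j < last_queue}. g j)) * laplace M (X n first_queue) (kappa \<eta> u)"
    using switch_step[of last_queue] prefix[of last_queue] by (simp only: refl if_True mult.assoc)
  also have "g last_queue * (\<Prod>j\<in>{j. j < last_queue}. g j) = (\<Prod>j\<in>insert last_queue {j. j < last_queue}. g j)"
    by simp
  also have "insert last_queue {j. j < last_queue} = (UNIV :: 'n set)"
    using le_last_queue[where i = "_ :: 'n"] unfolding order_le_less by blast
  finally show ?thesis by (simp add: G_transform_def g_def w_def)
qed

end


section \<open>Passage to the limit law\<close>

lemma tendsto_laplace:
  fixes X :: "'a \<Rightarrow> 'b::euclidean_space"
  assumes M: "prob_space M" and X: "X \<in> borel_measurable M"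
    and pos: "\<And>k. AE \<omega> in M. 0 \<le> u k \<bullet> X \<omega>" and lim: "u \<longlonglongrightarrow> v"
  shows "(\<lambda>k. laplace M X (u k)) \<longlonglongrightarrow> laplace M X v"
  unfolding laplace_def
proof (rule integral_dominated_convergence[where w = "\<lambda>_. 1"])
  interpret prob_space M by (rule M)
  show "integrable M (\<lambda>_. 1 :: real)" by simp
  show "AE \<omega> in M. norm (exp (- (u k \<bullet> X \<omega>))) \<le> 1" for k
    using pos[of k] by eventually_elim simp
  show "AE \<omega> in M. (\<lambda>k. exp (- (u k \<bullet> X \<omega>))) \<longlonglongrightarrow> exp (- (v \<bullet> X \<omega>))"
    by (intro AE_I2 tendsto_intros lim)
qed (intro borel_measurable_exp_inner X)+

lemma laplace_truncated:
  fixes X :: "'a \<Rightarrow> 'b::euclidean_space"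
  assumes X: "X \<in> borel_measurable M" and pos: "AE \<omega> in M. 0 \<le> u \<bullet> X \<omega>"
  shows "(\<integral>x. min 1 (exp (- (u \<bullet> x))) \<partial>distr M borel X) = laplace M X u"
proof -
  have meas: "(\<lambda>x. min 1 (exp (- (u \<bullet> x)))) \<in> borel_measurable borel"
    by (intro borel_measurable_min borel_measurable_exp_inner) simp_all
  have "(\<integral>x. min 1 (exp (- (u \<bullet> x))) \<partial>distr M borel X) = (\<integral>\<omega>. min 1 (exp (- (u \<bullet> X \<omega>))) \<partial>M)"
    by (rule integral_distr[OF X meas])
  also have "\<dots> = laplace M X u"
    unfolding laplace_def
  proof (rule integral_cong_AE)
    show "(\<lambda>\<omega>. min 1 (exp (- (u \<bullet> X \<omega>)))) \<in> borel_measurable M" by (rule measurable_compose[OF X meas])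
    show "AE \<omega> in M. min 1 (exp (- (u \<bullet> X \<omega>))) = exp (- (u \<bullet> X \<omega>))"
      using pos by eventually_elim (simp add: min_def)
  qed (rule borel_measurable_exp_inner[OF X])
  finally show ?thesis .
qed

text \<open>The test function is truncated at \<open>1\<close>, since \<open>exp (- (u \<bullet> x))\<close> is bounded only where
  \<open>u \<bullet> x\<close> is bounded below.\<close>

lemma converges_weakly_laplace:
  fixes X :: "nat \<Rightarrow> 'a \<Rightarrow> 'b::euclidean_space" and B :: "'p \<Rightarrow> 'b"
  assumes lim: "converges_weakly (\<lambda>n. distr M borel (X n)) (distr P borel B)"
    and X: "\<And>n. X n \<in> borel_measurable M" and B: "B \<in> borel_measurable P"
    and X_pos: "\<And>n. AE \<omega> in M. 0 \<le> u \<bullet> X n \<omega>" and B_pos: "AE \<omega> in P. 0 \<le> u \<bullet> B \<omega>"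
  shows "(\<lambda>n. laplace M (X n) u) \<longlonglongrightarrow> laplace P B u"
proof -
  define f where "f x = min 1 (exp (- (u \<bullet> x)))" for x :: 'b
  have f_cont: "continuous_on UNIV f" unfolding f_def by (intro continuous_intros)
  have "bounded (range f)"
    unfolding f_def by (rule boundedI[of _ 1]) (auto simp: min_def abs_if)
  with lim f_cont have "(\<lambda>n. \<integral>x. f x \<partial>distr M borel (X n)) \<longlonglongrightarrow> (\<integral>x. f x \<partial>distr P borel B)"
    by (simp add: converges_weakly_def)
  then show ?thesis
    unfolding f_def laplace_truncated[OF X X_pos] laplace_truncated[OF B B_pos] .
qed

text \<open>Two realizations occur: \<open>M\<close> carries the process whose limit law is that of
  \<open>B first_queue\<close>, and cycle \<open>0\<close> of \<open>M'\<close> starts from this law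
  and supplies the laws of all \<open>B i\<close> and \<open>E i\<close>.\<close>

theorem corollary1:
  fixes \<phi> :: "'n::{finite, linorder} rvec \<Rightarrow> real"
    and \<psi> \<eta> :: "'n \<Rightarrow> 'n rvec \<Rightarrow> real"
    and \<sigma> :: "'n \<Rightarrow> real measure"
    and m :: "'n rmat"
    and MG :: "'g measure" and G :: "'g \<Rightarrow> 'n rvec"
    and M :: "'a measure" and X Y :: "nat \<Rightarrow> 'n \<Rightarrow> 'a \<Rightarrow> 'n rvec"
    and M' :: "'b measure" and X' Y' :: "nat \<Rightarrow> 'n \<Rightarrow> 'b \<Rightarrow> 'n rvec"
    and P :: "'p measure" and B E :: "'n \<Rightarrow> 'p \<Rightarrow> 'n rvec"
  assumes mean_matrix: "\<And>i j. ((\<lambda>h. kappa \<eta> (h *\<^sub>R axis j 1) $ i) has_real_derivative m $ i $ j)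
        (at 0 within {0..})"
    and subcritical: "spectral_radius (complex_mat m) < 1"
    and G_vector: "prob_space MG" "G \<in> borel_measurable MG" "AE \<omega> in MG. 0 \<le> G \<omega>"
    and G_law: "\<And>u. 0 \<le> u \<Longrightarrow> laplace MG G u = G_transform \<phi> \<eta> \<sigma> u"
    and G_integrable: "integrable MG (\<lambda>\<omega>. norm (G \<omega>))"
    and system: "polling_workload M \<phi> \<psi> \<eta> \<sigma> X Y"
    and steady_cycle: "polling_workload M' \<phi> \<psi> \<eta> \<sigma> X' Y'"
    and steady_vectors: "prob_space P" "\<And>i. B i \<in> borel_measurable P" "\<And>i. E i \<in> borel_measurable P"
    and steady_limit: "converges_weakly (\<lambda>n. distr M borel (X n first_queue))
        (distr P borel (B first_queue))"
    and steady_begin: "\<And>i. distr P borel (B i) = distr M' borel (X' 0 i)"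
    and steady_end: "\<And>i. distr P borel (E i) = distr M' borel (Y' 0 i)"
  shows "(\<forall>i. \<forall>u\<ge>0.
            laplace P (B (next_queue i)) u = laplace P (E i) u * laplace (\<sigma> i) (\<lambda>s. s) (\<phi> u) \<and>
            laplace P (E i) u = laplace P (B i) (\<chi> j. if j = i then \<eta> i u else u $ j)) \<and>
         (\<forall>u\<ge>0. (\<lambda>k. G_transform \<phi> \<eta> \<sigma> ((kappa \<eta> ^^ k) u)) has_prod laplace P (B first_queue) u)"
proof -
  obtain A V H W D S where S: "polling_system M \<phi> \<psi> \<eta> \<sigma> X Y A V H W D S"
    using system unfolding polling_workload_def by blast
  obtain A' V' H' W' D' S' where S': "polling_system M' \<phi> \<psi> \<eta> \<sigma> X' Y' A' V' H' W' D' S'"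
    using steady_cycle unfolding polling_workload_def by blast
  interpret s: polling_system M \<phi> \<psi> \<eta> \<sigma> X Y A V H W D S by (rule S)
  interpret s': polling_system M' \<phi> \<psi> \<eta> \<sigma> X' Y' A' V' H' W' D' S' by (rule S')
  interpret P: prob_space P by (rule steady_vectors)
  let ?F = "first_queue :: 'n" and ?G = "G_transform \<phi> \<eta> \<sigma>" and ?L = "laplace P (B first_queue)"
  note \<eta> = s.subadditive_exponent_replacement
  note X_meas = s.measurable_known[OF s.visit_begin_known]
  note X'_meas = s'.measurable_known[OF s'.visit_begin_known]
  note Y'_meas = s'.measurable_known[OF s'.visit_end_known]
  \<comment> \<open>\<open>P\<close> and \<open>M'\<close> share laws only, so facts about
    \<open>B\<close> and \<open>E\<close> are transferred through distributions.\<close>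
  have B_X': "laplace P (B i) u = laplace M' (X' 0 i) u" for i u
    using arg_cong[OF steady_begin[of i], of "\<lambda>N. laplace N (\<lambda>x. x) u"]
    by (simp add: laplace_distr steady_vectors X'_meas)
  have E_Y': "laplace P (E i) u = laplace M' (Y' 0 i) u" for i u
    using arg_cong[OF steady_end[of i], of "\<lambda>N. laplace N (\<lambda>x. x) u"]
    by (simp add: laplace_distr steady_vectors Y'_meas)
  have B_pos: "AE \<omega> in P. 0 \<le> u \<bullet> B ?F \<omega>" if "0 \<le> u" for u
  proof -
    have "AE x in distr M' borel (X' 0 ?F). 0 \<le> u \<bullet> x"
      by (subst AE_distr_iff[OF X'_meas])
        (auto intro!: AE_I2 inner_vec_nonneg that s'.visit_begin_nonneg)
    then show ?thesis
      unfolding steady_begin[symmetric] by (subst (asm) AE_distr_iff[OF steady_vectors(2)]) auto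
  qed
  have lim: "(\<lambda>n. laplace M (X n ?F) u) \<longlonglongrightarrow> ?L u" if "0 \<le> u" for u
    by (rule converges_weakly_laplace[OF steady_limit X_meas steady_vectors(2) _ B_pos[OF that]])
      (intro AE_I2 inner_vec_nonneg that s.visit_begin_nonneg)
  \<comment> \<open>The cycle identity is taken to the limit; shifting the cycle by one does not
    change the limit of the left-hand side.\<close>
  have stationary: "?L u = ?G u * ?L (kappa \<eta> u)" if u: "0 \<le> u" for u
  proof (rule LIMSEQ_unique)
    show "(\<lambda>n. laplace M (X (Suc n) ?F) u) \<longlonglongrightarrow> ?L u" by (rule LIMSEQ_Suc[OF lim[OF u]])
    show "(\<lambda>n. laplace M (X (Suc n) ?F) u) \<longlonglongrightarrow> ?G u * ?L (kappa \<eta> u)"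
      unfolding s.laplace_cycle[OF u] by (intro tendsto_intros lim kappa_nonneg \<eta> u)
  qed
  \<comment> \<open>After the last queue the next visit belongs to cycle \<open>1\<close>, whose law
    \<open>steady_begin\<close> does not give; there \<open>stationary\<close> identifies its
    transform.\<close>
  have next_begin: "laplace M' (X' (if i = last_queue then Suc 0 else 0) (next_queue i)) u
      = laplace P (B (next_queue i)) u" if u: "0 \<le> u" for i u
  proof (cases "i = last_queue")
    case True
    have "laplace M' (X' (Suc 0) ?F) u = ?G u * ?L (kappa \<eta> u)"
      by (simp only: s'.laplace_cycle[OF u] B_X')
    also have "\<dots> = ?L u" by (rule stationary[OF u, symmetric])
    finally have "laplace M' (X' (Suc 0) ?F) u = ?L u" .
    then show ?thesis using True by (simp add: next_queue_def)
  next
    case False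
    then show ?thesis by (simp add: B_X')
  qed
  have "laplace P (B (next_queue i)) u = laplace P (E i) u * laplace (\<sigma> i) (\<lambda>s. s) (\<phi> u)"
    "laplace P (E i) u = laplace P (B i) (\<chi> j. if j = i then \<eta> i u else u $ j)" if "0 \<le> u" for i u
    using s'.laplace_switch_end[OF that, of i 0] s'.laplace_visit_end[OF that, of 0 i]
    unfolding next_begin[OF that] B_X' E_Y' by simp_all
  moreover have "(\<lambda>k. ?G ((kappa \<eta> ^^ k) u)) has_prod ?L u" if u: "0 \<le> u" for u
  proof -
    note \<kappa> = iterated_kappa_nonneg[of \<eta>, OF \<eta> u]
    have prods: "?L u = (\<Prod>k<n. ?G ((kappa \<eta> ^^ k) u)) * ?L ((kappa \<eta> ^^ n) u)" for n
    proof (induction n)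
      case (Suc n)
      then show ?case by (simp only: stationary[OF \<kappa>[of n]] prod.lessThan_Suc funpow.simps o_apply mult.assoc)
    qed simp
    have pos: "0 < ?L v" if "0 \<le> v" for v
      by (rule laplace_pos[OF steady_vectors(1,2) B_pos[OF that]])
    \<comment> \<open>The remainder factor tends to \<open>?L 0\<close>, which is \<open>1\<close>;
      hence the partial products converge to \<open>?L u\<close>.\<close>
    have "(\<lambda>n. ?L ((kappa \<eta> ^^ n) u)) \<longlonglongrightarrow> ?L 0"
      by (intro tendsto_laplace steady_vectors B_pos \<kappa> iterated_kappa_tendsto_0[OF \<eta> u mean_matrix subcritical])
    then have "(\<lambda>n. ?L u / ?L ((kappa \<eta> ^^ n) u)) \<longlonglongrightarrow> ?L u / ?L 0"
      using pos[of 0] by (intro tendsto_intros) auto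
    moreover have "?L 0 = 1" by (simp add: laplace_def P.prob_space)
    moreover have "?L u / ?L ((kappa \<eta> ^^ n) u) = (\<Prod>k<n. ?G ((kappa \<eta> ^^ k) u))" for n
      using prods[of n] pos[OF \<kappa>[of n]] by (simp add: divide_eq_eq)
    ultimately have "(\<lambda>n. \<Prod>k<n. ?G ((kappa \<eta> ^^ k) u)) \<longlonglongrightarrow> ?L u" by simp
    \<comment> \<open>\<open>has_prod\<close> is defined by partial products up to and including
      \<open>n\<close>, and its first alternative, taken here, demands a nonzero limit, which
      \<open>pos\<close> supplies.\<close>
    then have "(\<lambda>n. \<Prod>k\<le>n. ?G ((kappa \<eta> ^^ k) u)) \<longlonglongrightarrow> ?L u"
      by (subst (asm) LIMSEQ_lessThan_iff_atMost)
    then show ?thesis using pos[OF u] by (simp add: has_prod_def raw_has_prod_def)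
  qed
  ultimately show ?thesis by blast
qed

end
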